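(* There exist elements $\tilde z_1,\dots,\tilde z_n\in\mathbb{H}_{DO}$ and elements $p_{ij}\in\mathbb{C}[G]$ ($1\le i,j\le n$) such that $\mathbb{H}_{DO}$ is presented, as a unital associative $\mathbb{C}$-algebra, by the group algebra $\mathbb{C}[G]$ and the generators $\tilde z_1,\dots,\tilde z_n$ subject to the relations $$s_i\tilde z_j s_i^{-1}=\tilde z_{s_i(j)}\quad (1\le i\le n-1,\ 1\le j\le n),$$ $$g_i\tilde z_j=\tilde z_j g_i\quad (1\le i,j\le n),$$ $$[\tilde z_i,\tilde z_j]=p_{ij}\in\mathbb{C}[G]\quad (1\le i,j\le n).$$
   Context: Fix integers $m,n\ge 1$ and a parameter $\mathbf{k}\in\mathbb{C}$. Let $G=G(m,1,n)=S_n\ltimes T$, where $T=(\mathbb{Z}/m\mathbb{Z})^n$ is generated by commuting elements $g_1,\dots,g_n$ of order $m$ and $wg_iw^{-1}=g_{w(i)}$ for $w\in S_n$. Write $s_{i,j}\in S_n$ for the transposition of $i,j$ and $s_i=s_{i,i+1}$. The Dunkl-Opdam subalgebra $\mathbb{H}_{DO}=\mathbb{H}_{DO}(G(m,1,n))$ (a subalgebra of the rational Cherednik algebra of $G$) is the unital associative $\mathbb{C}$-algebra generated by $\mathbb{C}[G]$ and $z_1,\dots,z_n$ subject to $[z_i,z_j]=0$ for all $i,j$; $[z_i,g_r]=0$ for all $i,r$; $[z_j,s_i]=0$ for $j\ne i,i+1$; and $z_is_i=s_iz_{i+1}-\mathbf{k}\,\epsilon_{i,i+1}$ for $1\le i\le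 n-1$, where $\epsilon_{ij}=\sum_{l=0}^{m-1}g_i^lg_j^{-l}$. "Presented by" means that the natural map from the free product of $\mathbb{C}[G]$ with the free algebra on the stated generators, modulo the stated relations, to $\mathbb{H}_{DO}$ is an isomorphism. *)

theory Defs
  imports Complex_Main "HOL-Algebra.QuotRing" "HOL-Algebra.Module"
    "HOL-Algebra.Sym_Groups" "HOL-Algebra.Product_Groups" "HOL-Algebra.Elementary_Groups"
    "HOL-Library.Poly_Mapping" "HOL-Combinatorics.Transposition"
begin

section \<open>Associative unital algebras over the complex numbers\<close>

text \<open>
  The library locale \<^locale>\<open>algebra\<close> is restricted to commutative algebras. The record type of
  modules is reused here for not necessarily commutative algebras over \<^typ>\<open>complex\<close>.
\<close>

type_synonym 'a calg = "(complex, 'a) module"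

locale complex_algebra = ring A for A :: "'a calg" (structure) +
  assumes smult_closed: "a \<in> carrier A \<Longrightarrow> c \<odot> a \<in> carrier A"
    and smult_add_left: "a \<in> carrier A \<Longrightarrow> (c + d) \<odot> a = (c \<odot> a) \<oplus> (d \<odot> a)"
    and smult_add_right:
      "\<lbrakk>a \<in> carrier A; b \<in> carrier A\<rbrakk> \<Longrightarrow> c \<odot> (a \<oplus> b) = (c \<odot> a) \<oplus> (c \<odot> b)"
    and smult_smult: "a \<in> carrier A \<Longrightarrow> (c * d) \<odot> a = c \<odot> (d \<odot> a)"
    and smult_one: "a \<in> carrier A \<Longrightarrow> 1 \<odot> a = a"
    and smult_mult_left:
      "\<lbrakk>a \<in> carrier A; b \<in> carrier A\<rbrakk> \<Longrightarrow> (c \<odot> a) \<otimes> b = c \<odot> (a \<otimes> b)"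
    and smult_mult_right:
      "\<lbrakk>a \<in> carrier A; b \<in> carrier A\<rbrakk> \<Longrightarrow> a \<otimes> (c \<odot> b) = c \<odot> (a \<otimes> b)"

definition alg_iso :: "'a calg \<Rightarrow> 'b calg \<Rightarrow> ('a \<Rightarrow> 'b) set" where
  "alg_iso A B =
     {h \<in> ring_iso A B. \<forall>c. \<forall>a\<in>carrier A. h (c \<odot>\<^bsub>A\<^esub> a) = c \<odot>\<^bsub>B\<^esub> h a}"


subsection \<open>Quotient by a set of relations\<close>

text \<open>
  A relation \<open>l = r\<close> is represented by the pair \<open>(l, r)\<close>. In a ring that need not be commutative,
  \<^const>\<open>genideal\<close> is the two-sided ideal generated by a set; in an algebra it is automatically
  closed under scalars.
\<close>

definition rel_ideal :: "'a calg \<Rightarrow> ('a \<times> 'a) set \<Rightarrow> 'a set" where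
  "rel_ideal A R = Idl\<^bsub>A\<^esub> {l \<ominus>\<^bsub>A\<^esub> r |l r. (l, r) \<in> R}"

definition quot_proj :: "'a calg \<Rightarrow> ('a \<times> 'a) set \<Rightarrow> 'a \<Rightarrow> 'a set" where
  "quot_proj A R a = rel_ideal A R +>\<^bsub>A\<^esub> a"

definition quot_alg :: "'a calg \<Rightarrow> ('a \<times> 'a) set \<Rightarrow> 'a set calg" where
  "quot_alg A R =
     (let I = rel_ideal A R; Q = A Quot I in
      \<lparr>carrier = carrier Q, monoid.mult = monoid.mult Q, one = one Q, ring.zero = ring.zero Q, ring.add = ring.add Q,
       smult = (\<lambda>c C. \<Union>a\<in>C. I +>\<^bsub>A\<^esub> (c \<odot>\<^bsub>A\<^esub> a))\<rparr>)"


subsection \<open>Monoid algebras and free algebras\<close>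

definition monoid_algebra :: "('a, 'm) monoid_scheme \<Rightarrow> ('a \<Rightarrow>\<^sub>0 complex) calg" where
  "monoid_algebra M =
     \<lparr>carrier = {f. Poly_Mapping.keys f \<subseteq> carrier M},
      monoid.mult = (\<lambda>f g. \<Sum>a\<in>Poly_Mapping.keys f. \<Sum>b\<in>Poly_Mapping.keys g.
                Poly_Mapping.single (a \<otimes>\<^bsub>M\<^esub> b) (Poly_Mapping.lookup f a * Poly_Mapping.lookup g b)),
      one = Poly_Mapping.single \<one>\<^bsub>M\<^esub> 1,
      ring.zero = 0,
      ring.add = (+),
      smult = (\<lambda>c. Poly_Mapping.map ((*) c))\<rparr>"

definition basis_elt :: "'a \<Rightarrow> 'a \<Rightarrow>\<^sub>0 complex" where
  "basis_elt a = Poly_Mapping.single a 1"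

definition free_monoid :: "'x set \<Rightarrow> 'x list monoid" where
  "free_monoid V = \<lparr>carrier = lists V, monoid.mult = (@), one = []\<rparr>"

definition free_algebra :: "'x set \<Rightarrow> ('x list \<Rightarrow>\<^sub>0 complex) calg" where
  "free_algebra V = monoid_algebra (free_monoid V)"

definition free_gen :: "'x \<Rightarrow> 'x list \<Rightarrow>\<^sub>0 complex" where
  "free_gen x = basis_elt [x]"


subsection \<open>Free products\<close>

text \<open>The relations that force a map \<open>\<iota>\<close> from \<open>A\<close> to \<open>F\<close> to be a homomorphism of unital algebras.\<close>

definition hom_relations :: "'a calg \<Rightarrow> 'f calg \<Rightarrow> ('a \<Rightarrow> 'f) \<Rightarrow> ('f \<times> 'f) set" where
  "hom_relations A F \<iota> =
     {(\<iota> (a \<oplus>\<^bsub>A\<^esub> b), \<iota> a \<oplus>\<^bsub>F\<^esub> \<iota> b) |a b. a \<in> carrier A \<and> b \<in> carrier A} \<union>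
     {(\<iota> (a \<otimes>\<^bsub>A\<^esub> b), \<iota> a \<otimes>\<^bsub>F\<^esub> \<iota> b) |a b. a \<in> carrier A \<and> b \<in> carrier A} \<union>
     {(\<iota> (c \<odot>\<^bsub>A\<^esub> a), c \<odot>\<^bsub>F\<^esub> \<iota> a) |c a. a \<in> carrier A} \<union>
     {(\<iota> \<one>\<^bsub>A\<^esub>, \<one>\<^bsub>F\<^esub>)}"

text \<open>
  The free product (coproduct of unital algebras): the free algebra on the disjoint union of the
  two carriers, modulo the relations making both inclusions homomorphisms.
\<close>

type_synonym ('a, 'b) fprod = "(('a + 'b) list \<Rightarrow>\<^sub>0 complex) set"

definition fprod_free :: "'a calg \<Rightarrow> 'b calg \<Rightarrow> (('a + 'b) list \<Rightarrow>\<^sub>0 complex) calg" where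
  "fprod_free A B = free_algebra (carrier A <+> carrier B)"

definition fprod_relations ::
  "'a calg \<Rightarrow> 'b calg \<Rightarrow> ((('a + 'b) list \<Rightarrow>\<^sub>0 complex) \<times> (('a + 'b) list \<Rightarrow>\<^sub>0 complex)) set" where
  "fprod_relations A B =
     hom_relations A (fprod_free A B) (\<lambda>a. free_gen (Inl a)) \<union>
     hom_relations B (fprod_free A B) (\<lambda>b. free_gen (Inr b))"

definition free_product :: "'a calg \<Rightarrow> 'b calg \<Rightarrow> ('a, 'b) fprod calg" where
  "free_product A B = quot_alg (fprod_free A B) (fprod_relations A B)"

definition fprod_inl :: "'a calg \<Rightarrow> 'b calg \<Rightarrow> 'a \<Rightarrow> ('a, 'b) fprod" where
  "fprod_inl A B a = quot_proj (fprod_free A B) (fprod_relations A B) (free_gen (Inl a))"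

definition fprod_inr :: "'a calg \<Rightarrow> 'b calg \<Rightarrow> 'b \<Rightarrow> ('a, 'b) fprod" where
  "fprod_inr A B b = quot_proj (fprod_free A B) (fprod_relations A B) (free_gen (Inr b))"


subsection \<open>Presentations over a base algebra\<close>

type_synonym ('a, 'x) adj = "('a, 'x list \<Rightarrow>\<^sub>0 complex) fprod"

definition adjoin :: "'a calg \<Rightarrow> 'x set \<Rightarrow> ('a, 'x) adj calg" where
  "adjoin A V = free_product A (free_algebra V)"

definition adj_base :: "'a calg \<Rightarrow> 'x set \<Rightarrow> 'a \<Rightarrow> ('a, 'x) adj" where
  "adj_base A V = fprod_inl A (free_algebra V)"

definition adj_gen :: "'a calg \<Rightarrow> 'x set \<Rightarrow> 'x \<Rightarrow> ('a, 'x) adj" where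
  "adj_gen A V x = fprod_inr A (free_algebra V) (free_gen x)"

text \<open>
  \<open>B\<close>, equipped with \<open>f : A \<rightarrow> B\<close> and elements \<open>b x\<close>, is presented by \<open>A\<close> and generators \<open>x \<in> V\<close>
  subject to \<open>R\<close>: there is an algebra isomorphism \<open>(A * \<complex>\<langle>V\<rangle>) / (R) \<rightarrow> B\<close> that extends \<open>f\<close> and sends
  the class of \<open>x\<close> to \<open>b x\<close>. A homomorphism with these values is unique, because \<open>A\<close> and \<open>V\<close> generate
  the quotient, so the isomorphism is the natural map.
\<close>

definition presented_by ::
  "'b calg \<Rightarrow> 'a calg \<Rightarrow> ('a \<Rightarrow> 'b) \<Rightarrow> 'x set \<Rightarrow> ('x \<Rightarrow> 'b) \<Rightarrow>
     (('a, 'x) adj \<times> ('a, 'x) adj) set \<Rightarrow> bool" where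
  "presented_by B A f V b R \<longleftrightarrow>
     (\<exists>\<phi> \<in> alg_iso (quot_alg (adjoin A V) R) B.
        (\<forall>a\<in>carrier A. \<phi> (quot_proj (adjoin A V) R (adj_base A V a)) = f a) \<and>
        (\<forall>x\<in>V. \<phi> (quot_proj (adjoin A V) R (adj_gen A V x)) = b x))"


section \<open>The group \<open>G(m,1,n)\<close>\<close>

type_synonym gelt = "(nat \<Rightarrow> nat) \<times> (nat \<Rightarrow> int)"

definition torus :: "nat \<Rightarrow> nat \<Rightarrow> (nat \<Rightarrow> int) monoid" where
  "torus m n = product_group {1..n} (\<lambda>_. integer_mod_group m)"

text \<open>
  The pair \<open>(w, t)\<close> stands for \<open>w \<cdot> (g\<^sub>1 ^ t 1 \<cdots> g\<^sub>n ^ t n)\<close>. Since \<open>w g\<^sub>i w\<^sup>-\<^sup>1 = g\<^bsub>w i\<^esub>\<close>, moving \<open>t\<close> to the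
  right past \<open>w'\<close> replaces \<open>t j\<close> by \<open>t (w' j)\<close>.
\<close>

definition G_grp :: "nat \<Rightarrow> nat \<Rightarrow> gelt monoid" where
  "G_grp m n =
     \<lparr>carrier = carrier (sym_group n) \<times> carrier (torus m n),
      monoid.mult = (\<lambda>(w, t) (w', t').
                (w \<otimes>\<^bsub>sym_group n\<^esub> w', (\<lambda>j\<in>{1..n}. t (w' j)) \<otimes>\<^bsub>torus m n\<^esub> t')),
      one = (\<one>\<^bsub>sym_group n\<^esub>, \<one>\<^bsub>torus m n\<^esub>)\<rparr>"

definition g_elt :: "nat \<Rightarrow> nat \<Rightarrow> nat \<Rightarrow> gelt" where
  "g_elt m n i = (id, \<lambda>j\<in>{1..n}. if j = i then 1 mod int m else 0)"

definition perm_elt :: "nat \<Rightarrow> nat \<Rightarrow> (nat \<Rightarrow> nat) \<Rightarrow> gelt" where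
  "perm_elt m n w = (w, \<one>\<^bsub>torus m n\<^esub>)"

definition s_elt :: "nat \<Rightarrow> nat \<Rightarrow> nat \<Rightarrow> gelt" where
  "s_elt m n i = perm_elt m n (transpose i (i + 1))"

definition CG :: "nat \<Rightarrow> nat \<Rightarrow> (gelt \<Rightarrow>\<^sub>0 complex) calg" where
  "CG m n = monoid_algebra (G_grp m n)"

definition eps :: "nat \<Rightarrow> nat \<Rightarrow> nat \<Rightarrow> nat \<Rightarrow> gelt \<Rightarrow>\<^sub>0 complex" where
  "eps m n i j =
     (\<Sum>l<m. basis_elt
        (g_elt m n i [^]\<^bsub>G_grp m n\<^esub> int l \<otimes>\<^bsub>G_grp m n\<^esub> g_elt m n j [^]\<^bsub>G_grp m n\<^esub> (- int l)))"


section \<open>The Dunkl-Opdam subalgebra\<close>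

type_synonym CG_adj = "(gelt \<Rightarrow>\<^sub>0 complex, nat) adj"

abbreviation CG_free :: "nat \<Rightarrow> nat \<Rightarrow> CG_adj calg" where
  "CG_free m n \<equiv> adjoin (CG m n) {1..n}"

abbreviation CG_in :: "nat \<Rightarrow> nat \<Rightarrow> (gelt \<Rightarrow>\<^sub>0 complex) \<Rightarrow> CG_adj" where
  "CG_in m n \<equiv> adj_base (CG m n) {1..n}"

abbreviation G_in :: "nat \<Rightarrow> nat \<Rightarrow> gelt \<Rightarrow> CG_adj" where
  "G_in m n x \<equiv> CG_in m n (basis_elt x)"

abbreviation Z_in :: "nat \<Rightarrow> nat \<Rightarrow> nat \<Rightarrow> CG_adj" where
  "Z_in m n \<equiv> adj_gen (CG m n) {1..n}"

definition DO_relations :: "nat \<Rightarrow> nat \<Rightarrow> complex \<Rightarrow> (CG_adj \<times> CG_adj) set" where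
  "DO_relations m n k =
     (let F = CG_free m n; z = Z_in m n;
          g = (\<lambda>i. G_in m n (g_elt m n i)); s = (\<lambda>i. G_in m n (s_elt m n i))
      in
       {(z i \<otimes>\<^bsub>F\<^esub> z j, z j \<otimes>\<^bsub>F\<^esub> z i) |i j. i \<in> {1..n} \<and> j \<in> {1..n}} \<union>
       {(z i \<otimes>\<^bsub>F\<^esub> g r, g r \<otimes>\<^bsub>F\<^esub> z i) |i r. i \<in> {1..n} \<and> r \<in> {1..n}} \<union>
       {(z j \<otimes>\<^bsub>F\<^esub> s i, s i \<otimes>\<^bsub>F\<^esub> z j) |i j.
          i \<in> {1..<n} \<and> j \<in> {1..n} \<and> j \<noteq> i \<and> j \<noteq> i + 1} \<union>
       {(z i \<otimes>\<^bsub>F\<^esub> s i,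
         (s i \<otimes>\<^bsub>F\<^esub> z (i + 1)) \<ominus>\<^bsub>F\<^esub> (k \<odot>\<^bsub>F\<^esub> CG_in m n (eps m n i (i + 1)))) |i.
          i \<in> {1..<n}})"

definition H_DO :: "nat \<Rightarrow> nat \<Rightarrow> complex \<Rightarrow> CG_adj set calg" where
  "H_DO m n k = quot_alg (CG_free m n) (DO_relations m n k)"

definition H_DO_base :: "nat \<Rightarrow> nat \<Rightarrow> complex \<Rightarrow> (gelt \<Rightarrow>\<^sub>0 complex) \<Rightarrow> CG_adj set" where
  "H_DO_base m n k a = quot_proj (CG_free m n) (DO_relations m n k) (CG_in m n a)"

definition tilde_relations ::
  "nat \<Rightarrow> nat \<Rightarrow> (nat \<Rightarrow> nat \<Rightarrow> gelt \<Rightarrow>\<^sub>0 complex) \<Rightarrow> (CG_adj \<times> CG_adj) set" where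
  "tilde_relations m n p =
     (let F = CG_free m n; z = Z_in m n; G = G_grp m n in
       {(G_in m n (s_elt m n i) \<otimes>\<^bsub>F\<^esub> z j \<otimes>\<^bsub>F\<^esub> G_in m n (inv\<^bsub>G\<^esub> (s_elt m n i)),
         z (transpose i (i + 1) j)) |i j. i \<in> {1..<n} \<and> j \<in> {1..n}} \<union>
       {(G_in m n (g_elt m n i) \<otimes>\<^bsub>F\<^esub> z j, z j \<otimes>\<^bsub>F\<^esub> G_in m n (g_elt m n i)) |i j.
          i \<in> {1..n} \<and> j \<in> {1..n}} \<union>
       {((z i \<otimes>\<^bsub>F\<^esub> z j) \<ominus>\<^bsub>F\<^esub> (z j \<otimes>\<^bsub>F\<^esub> z i), CG_in m n (p i j)) |i j.
          i \<in> {1..n} \<and> j \<in> {1..n}})"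


section \<open>Well-formedness\<close>

text \<open>
  The structures above are indeed groups and complex algebras, and all relations lie in the carriers;
  in particular \<^const>\<open>genideal\<close> is never applied to elements outside the carrier.
\<close>

lemma lookup_map_scale: "Poly_Mapping.lookup (Poly_Mapping.map ((*) c) f) x = c * Poly_Mapping.lookup f x" for c :: complex
  by (simp add: map.rep_eq when_def)

lemma poly_mapping_expand:
  assumes "finite K" "Poly_Mapping.keys f \<subseteq> K"
  shows "f = (\<Sum>a\<in>K. Poly_Mapping.single a (Poly_Mapping.lookup f a))"
proof (rule poly_mapping_eqI)
  fix x
  have "(\<Sum>a\<in>K. Poly_Mapping.lookup (Poly_Mapping.single a (Poly_Mapping.lookup f a)) x)
      = (\<Sum>a\<in>K. if a = x then Poly_Mapping.lookup f x else 0)"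
    by (intro sum.cong) (auto simp: lookup_single when_def)
  then show "Poly_Mapping.lookup f x = Poly_Mapping.lookup (\<Sum>a\<in>K. Poly_Mapping.single a (Poly_Mapping.lookup f a)) x"
    using assms by (auto simp: lookup_sum in_keys_iff)
qed

lemma ma_mult_expand:
  assumes "finite K" "Poly_Mapping.keys f \<subseteq> K" "finite L" "Poly_Mapping.keys g \<subseteq> L"
  shows "f \<otimes>\<^bsub>monoid_algebra M\<^esub> g = (\<Sum>a\<in>K. \<Sum>b\<in>L.
     Poly_Mapping.single (a \<otimes>\<^bsub>M\<^esub> b) (Poly_Mapping.lookup f a * Poly_Mapping.lookup g b))"
proof -
  have "(\<Sum>b\<in>Poly_Mapping.keys g. Poly_Mapping.single (a \<otimes>\<^bsub>M\<^esub> b) (Poly_Mapping.lookup f a * Poly_Mapping.lookup g b))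
     = (\<Sum>b\<in>L. Poly_Mapping.single (a \<otimes>\<^bsub>M\<^esub> b) (Poly_Mapping.lookup f a * Poly_Mapping.lookup g b))" for a
    using assms by (intro sum.mono_neutral_left) (auto simp: in_keys_iff)
  moreover have "(\<Sum>a\<in>Poly_Mapping.keys f. \<Sum>b\<in>L. Poly_Mapping.single (a \<otimes>\<^bsub>M\<^esub> b) (Poly_Mapping.lookup f a * Poly_Mapping.lookup g b))
     = (\<Sum>a\<in>K. \<Sum>b\<in>L. Poly_Mapping.single (a \<otimes>\<^bsub>M\<^esub> b) (Poly_Mapping.lookup f a * Poly_Mapping.lookup g b))"
    using assms by (intro sum.mono_neutral_left) (auto simp: in_keys_iff)
  ultimately show ?thesis by (simp add: monoid_algebra_def)
qed

lemma ma_mult_add_left: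
  "(f + f') \<otimes>\<^bsub>monoid_algebra M\<^esub> g = (f \<otimes>\<^bsub>monoid_algebra M\<^esub> g) + (f' \<otimes>\<^bsub>monoid_algebra M\<^esub> g)"
proof -
  let ?K = "Poly_Mapping.keys f \<union> Poly_Mapping.keys f'"
  have *: "finite ?K" "Poly_Mapping.keys (f + f') \<subseteq> ?K" "Poly_Mapping.keys f \<subseteq> ?K" "Poly_Mapping.keys f' \<subseteq> ?K"
    "finite (Poly_Mapping.keys g)" "Poly_Mapping.keys g \<subseteq> Poly_Mapping.keys g"
    using Poly_Mapping.keys_add[of f f'] by auto
  show ?thesis
    unfolding ma_mult_expand[OF *(1,2,5,6)] ma_mult_expand[OF *(1,3,5,6)] ma_mult_expand[OF *(1,4,5,6)]
    by (simp add: lookup_add distrib_right single_add sum.distrib)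
qed

lemma ma_mult_add_right:
  "g \<otimes>\<^bsub>monoid_algebra M\<^esub> (f + f') = (g \<otimes>\<^bsub>monoid_algebra M\<^esub> f) + (g \<otimes>\<^bsub>monoid_algebra M\<^esub> f')"
proof -
  let ?K = "Poly_Mapping.keys f \<union> Poly_Mapping.keys f'"
  have *: "finite ?K" "Poly_Mapping.keys (f + f') \<subseteq> ?K" "Poly_Mapping.keys f \<subseteq> ?K" "Poly_Mapping.keys f' \<subseteq> ?K"
    "finite (Poly_Mapping.keys g)" "Poly_Mapping.keys g \<subseteq> Poly_Mapping.keys g"
    using Poly_Mapping.keys_add[of f f'] by auto
  show ?thesis
    unfolding ma_mult_expand[OF *(5,6,1,2)] ma_mult_expand[OF *(5,6,1,3)] ma_mult_expand[OF *(5,6,1,4)]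
    by (simp add: lookup_add distrib_left single_add sum.distrib)
qed

lemma ma_mult_zero: "0 \<otimes>\<^bsub>monoid_algebra M\<^esub> g = 0" "g \<otimes>\<^bsub>monoid_algebra M\<^esub> 0 = 0"
  by (simp_all add: monoid_algebra_def)

lemma ma_mult_sum_left: "(\<Sum>i\<in>I. f i) \<otimes>\<^bsub>monoid_algebra M\<^esub> g = (\<Sum>i\<in>I. f i \<otimes>\<^bsub>monoid_algebra M\<^esub> g)"
  by (induct I rule: infinite_finite_induct) (auto simp: ma_mult_zero ma_mult_add_left)

lemma ma_mult_sum_right: "g \<otimes>\<^bsub>monoid_algebra M\<^esub> (\<Sum>i\<in>I. f i) = (\<Sum>i\<in>I. g \<otimes>\<^bsub>monoid_algebra M\<^esub> f i)"
  by (induct I rule: infinite_finite_induct) (auto simp: ma_mult_zero ma_mult_add_right)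

lemma ma_mult_single: "Poly_Mapping.single a c \<otimes>\<^bsub>monoid_algebra M\<^esub> Poly_Mapping.single b d
    = Poly_Mapping.single (a \<otimes>\<^bsub>M\<^esub> b) (c * d)"
  using ma_mult_expand[of "{a}" "Poly_Mapping.single a c" "{b}" "Poly_Mapping.single b d" M] by simp

lemma ma_simps:
  "carrier (monoid_algebra M) = {f. Poly_Mapping.keys f \<subseteq> carrier M}"
  "\<one>\<^bsub>monoid_algebra M\<^esub> = Poly_Mapping.single \<one>\<^bsub>M\<^esub> 1"
  "\<zero>\<^bsub>monoid_algebra M\<^esub> = 0"
  "f \<oplus>\<^bsub>monoid_algebra M\<^esub> g = f + g"
  "c \<odot>\<^bsub>monoid_algebra M\<^esub> f = Poly_Mapping.map ((*) c) f"
  by (simp_all add: monoid_algebra_def)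

lemma ma_induct:
  fixes f :: "'a \<Rightarrow>\<^sub>0 complex"
  assumes "Poly_Mapping.keys f \<subseteq> S"
    and "\<And>a c. a \<in> S \<Longrightarrow> P (Poly_Mapping.single a c)" and "P 0" and "\<And>f g. P f \<Longrightarrow> P g \<Longrightarrow> P (f + g)"
  shows "P f"
proof -
  have "P (\<Sum>a\<in>A. Poly_Mapping.single a (Poly_Mapping.lookup f a))" if "finite A" "A \<subseteq> S" for A
    using that by (induct A) (auto intro: assms)
  from this[OF _ assms(1)] show ?thesis
    using poly_mapping_expand[of "Poly_Mapping.keys f" f] by simp
qed

lemma complex_algebra_ma:
  fixes M :: "'a monoid"
  assumes "monoid M" shows "complex_algebra (monoid_algebra M)"
proof -
  interpret monoid M by fact
  let ?A = "monoid_algebra M"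
  let ?K = "\<lambda>f :: 'a \<Rightarrow>\<^sub>0 complex. Poly_Mapping.keys f \<subseteq> carrier M"
  note lin = ma_mult_single ma_mult_zero ma_mult_add_left ma_mult_add_right
  have kadd: "?K (f + g)" if "?K f" "?K g" for f g
    using that Poly_Mapping.keys_add[of f g] by blast
  have kscale: "?K (Poly_Mapping.map ((*) c) f)" if "?K f" for c f
    using that by (auto simp: in_keys_iff lookup_map_scale)
  have closed: "?K (f \<otimes>\<^bsub>?A\<^esub> g)" if f: "?K f" and g: "?K g" for f g
  proof (rule ma_induct[OF f])
    fix a c assume a: "a \<in> carrier M"
    show "?K (Poly_Mapping.single a c \<otimes>\<^bsub>?A\<^esub> g)"
      by (rule ma_induct[OF g]) (simp_all add: lin kadd a)
  qed (simp_all add: lin kadd)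
  have assoc: "f \<otimes>\<^bsub>?A\<^esub> g \<otimes>\<^bsub>?A\<^esub> h = f \<otimes>\<^bsub>?A\<^esub> (g \<otimes>\<^bsub>?A\<^esub> h)"
    if f: "?K f" and g: "?K g" and h: "?K h" for f g h
  proof (rule ma_induct[OF f])
    fix a c assume a: "a \<in> carrier M"
    show "Poly_Mapping.single a c \<otimes>\<^bsub>?A\<^esub> g \<otimes>\<^bsub>?A\<^esub> h = Poly_Mapping.single a c \<otimes>\<^bsub>?A\<^esub> (g \<otimes>\<^bsub>?A\<^esub> h)"
    proof (rule ma_induct[OF g])
      fix b d assume b: "b \<in> carrier M"
      show "Poly_Mapping.single a c \<otimes>\<^bsub>?A\<^esub> Poly_Mapping.single b d \<otimes>\<^bsub>?A\<^esub> h
        = Poly_Mapping.single a c \<otimes>\<^bsub>?A\<^esub> (Poly_Mapping.single b d \<otimes>\<^bsub>?A\<^esub> h)"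
        by (rule ma_induct[OF h]) (simp_all add: lin m_assoc mult.assoc a b)
    qed (simp_all add: lin)
  qed (simp_all add: lin)
  have lone: "Poly_Mapping.single \<one>\<^bsub>M\<^esub> 1 \<otimes>\<^bsub>?A\<^esub> f = f" if "?K f" for f
    by (rule ma_induct[OF that]) (simp_all add: lin)
  have rone: "f \<otimes>\<^bsub>?A\<^esub> Poly_Mapping.single \<one>\<^bsub>M\<^esub> 1 = f" if "?K f" for f
    by (rule ma_induct[OF that]) (simp_all add: lin)
  have sadd: "Poly_Mapping.map ((*) c) (f + g) = Poly_Mapping.map ((*) c) f + Poly_Mapping.map ((*) c) g"
    for c and f g :: "'a \<Rightarrow>\<^sub>0 complex"
    by (rule poly_mapping_eqI) (simp add: lookup_map_scale lookup_add distrib_left)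
  have s0: "Poly_Mapping.map ((*) c) (0 :: 'a \<Rightarrow>\<^sub>0 complex) = 0" for c
    by (rule poly_mapping_eqI) (simp add: lookup_map_scale)
  have ss: "Poly_Mapping.map ((*) c) (Poly_Mapping.single a d) = Poly_Mapping.single a (c * d)"
    for c d :: complex and a :: 'a
    by (rule poly_mapping_eqI) (simp add: lookup_map_scale lookup_single when_def)
  have ml: "Poly_Mapping.map ((*) c) f \<otimes>\<^bsub>?A\<^esub> g = Poly_Mapping.map ((*) c) (f \<otimes>\<^bsub>?A\<^esub> g)"
    if f: "?K f" and g: "?K g" for c f g
  proof (rule ma_induct[OF f])
    fix a d assume "a \<in> carrier M"
    show "Poly_Mapping.map ((*) c) (Poly_Mapping.single a d) \<otimes>\<^bsub>?A\<^esub> g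
      = Poly_Mapping.map ((*) c) (Poly_Mapping.single a d \<otimes>\<^bsub>?A\<^esub> g)"
      by (rule ma_induct[OF g]) (simp_all add: lin sadd ss s0 mult.assoc)
  qed (simp_all add: lin sadd s0)
  have mr: "f \<otimes>\<^bsub>?A\<^esub> Poly_Mapping.map ((*) c) g = Poly_Mapping.map ((*) c) (f \<otimes>\<^bsub>?A\<^esub> g)"
    if f: "?K f" and g: "?K g" for c f g
  proof (rule ma_induct[OF f])
    fix a d assume "a \<in> carrier M"
    show "Poly_Mapping.single a d \<otimes>\<^bsub>?A\<^esub> Poly_Mapping.map ((*) c) g
      = Poly_Mapping.map ((*) c) (Poly_Mapping.single a d \<otimes>\<^bsub>?A\<^esub> g)"
      by (rule ma_induct[OF g]) (simp_all add: lin sadd ss s0 mult.left_commute)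
  qed (simp_all add: lin sadd s0)
  have "ring ?A"
  proof (intro ringI abelian_groupI monoidI)
    show "\<exists>g\<in>carrier ?A. g \<oplus>\<^bsub>?A\<^esub> f = \<zero>\<^bsub>?A\<^esub>" if "f \<in> carrier ?A" for f
      by (rule bexI[of _ "- f"]) (use that in \<open>simp_all add: ma_simps\<close>)
  qed (simp_all add: ma_simps closed assoc lone rone kadd add.assoc add.commute
      ma_mult_add_left ma_mult_add_right add.left_commute)
  moreover have "complex_algebra_axioms ?A"
  proof
    show "(c + d) \<odot>\<^bsub>?A\<^esub> f = (c \<odot>\<^bsub>?A\<^esub> f) \<oplus>\<^bsub>?A\<^esub> (d \<odot>\<^bsub>?A\<^esub> f)" for c d f
      unfolding ma_simps
      by (rule poly_mapping_eqI) (simp add: lookup_map_scale lookup_add distrib_right)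
    show "(c * d) \<odot>\<^bsub>?A\<^esub> f = c \<odot>\<^bsub>?A\<^esub> (d \<odot>\<^bsub>?A\<^esub> f)" for c d f
      unfolding ma_simps by (rule poly_mapping_eqI) (simp add: lookup_map_scale)
    show "1 \<odot>\<^bsub>?A\<^esub> f = f" for f
      unfolding ma_simps by (rule poly_mapping_eqI) (simp only: lookup_map_scale mult_1)
  qed (simp_all add: ma_simps sadd ml mr kscale)
  ultimately show ?thesis by (rule complex_algebra.intro)
qed

lemma group_G: "group (G_grp m n)"
proof -
  note [simp del] = One_nat_def
  interpret S: group "sym_group n" by (rule sym_group_is_group)
  interpret T: group "torus m n" unfolding torus_def by (rule product_group) simp
  have perm: "w j \<in> {1..n}" if "w permutes {1..n}" "j \<in> {1..n}" for w j using that permutes_in_image by metis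
  have act: "(\<lambda>j\<in>{1..n}. t (w j)) \<in> carrier (torus m n)"
    if "w permutes {1..n}" "t \<in> carrier (torus m n)" for w t
    using that perm unfolding torus_def by (fastforce simp: PiE_iff)
  show ?thesis
  proof (rule groupI)
    show "x \<otimes>\<^bsub>G_grp m n\<^esub> y \<in> carrier (G_grp m n)" if "x \<in> carrier (G_grp m n)" "y \<in> carrier (G_grp m n)" for x y
      using that by (auto simp: G_grp_def act sym_group_def permutes_compose)
    show "\<one>\<^bsub>G_grp m n\<^esub> \<in> carrier (G_grp m n)" by (simp add: G_grp_def)
    show "x \<otimes>\<^bsub>G_grp m n\<^esub> y \<otimes>\<^bsub>G_grp m n\<^esub> z = x \<otimes>\<^bsub>G_grp m n\<^esub> (y \<otimes>\<^bsub>G_grp m n\<^esub> z)"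
      if "x \<in> carrier (G_grp m n)" "y \<in> carrier (G_grp m n)" "z \<in> carrier (G_grp m n)" for x y z
      using that perm by (auto simp: G_grp_def sym_group_def torus_def fun_eq_iff mod_simps add.assoc)
    show "\<one>\<^bsub>G_grp m n\<^esub> \<otimes>\<^bsub>G_grp m n\<^esub> x = x" if xx: "x \<in> carrier (G_grp m n)" for x
    proof -
      obtain w t where x: "x = (w,t)" "w permutes {1..n}" "t \<in> carrier (torus m n)" using xx unfolding G_grp_def sym_group_def by auto
      have "(\<lambda>j\<in>{1..n}. \<one>\<^bsub>torus m n\<^esub> (w j)) = \<one>\<^bsub>torus m n\<^esub>" using perm[OF x(2)] by (auto simp: torus_def)
      then show ?thesis using x by (simp add: G_grp_def sym_group_def)
    qed
    show "\<exists>y\<in>carrier (G_grp m n). y \<otimes>\<^bsub>G_grp m n\<^esub> x = \<one>\<^bsub>G_grp m n\<^esub>" if xx: "x \<in> carrier (G_grp m n)" for x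
    proof -
      obtain w t where x: "x = (w,t)" "w permutes {1..n}" "t \<in> carrier (torus m n)" using xx unfolding G_grp_def sym_group_def by auto
      let ?u = "inv\<^bsub>torus m n\<^esub> t" let ?v = "Hilbert_Choice.inv w"
      have u: "?u \<in> carrier (torus m n)" using x by simp
      have "(\<lambda>j\<in>{1..n}. (\<lambda>j\<in>{1..n}. ?u (?v j)) (w j)) = ?u"
        using u perm[OF x(2)] permutes_inverses(2)[OF x(2)] by (auto simp: torus_def PiE_iff extensional_def fun_eq_iff)
      then show ?thesis using x act[OF permutes_inv[OF x(2)] u]
        by (intro bexI[of _ "(?v, (\<lambda>j\<in>{1..n}. ?u (?v j)))"]) (auto simp: G_grp_def sym_group_def permutes_inv permutes_inv_o)
    qed
  qed
qed

lemma g_elt_closed: "m \<ge> 1 \<Longrightarrow> g_elt m n i \<in> carrier (G_grp m n)"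
  by (auto simp: G_grp_def g_elt_def sym_group_def permutes_id torus_def integer_mod_group_def)

lemma s_elt_closed: "i \<in> {1..<n} \<Longrightarrow> s_elt m n i \<in> carrier (G_grp m n)"
  unfolding s_elt_def perm_elt_def G_grp_def torus_def
  by (auto simp: sym_group_def integer_mod_group_def intro!: permutes_swap_id)

lemma perm_elt_g_elt:
  assumes w: "w permutes {1..n}" and "i \<in> {1..n}" "m \<ge> 1"
  shows "perm_elt m n w \<otimes>\<^bsub>G_grp m n\<^esub> g_elt m n i = g_elt m n (w i) \<otimes>\<^bsub>G_grp m n\<^esub> perm_elt m n w"
proof -
  have "w j \<in> {1..n}" if "j \<in> {1..n}" for j
    using permutes_in_image[OF w] that by simp
  moreover have "w j = w i \<longleftrightarrow> j = i" for j
    using permutes_inj[OF w] by (simp add: inj_eq)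
  ultimately show ?thesis
    by (simp add: G_grp_def g_elt_def perm_elt_def sym_group_def torus_def fun_eq_iff del: One_nat_def)
qed

lemma complex_algebra_quot:
  assumes "complex_algebra A" "R \<subseteq> carrier A \<times> carrier A"
  shows "complex_algebra (quot_alg A R)"
proof -
  interpret complex_algebra A by fact
  have I: "ideal (rel_ideal A R) A" unfolding rel_ideal_def
    using assms(2) by (intro genideal_ideal) auto
  interpret I: ideal "rel_ideal A R" A by (rule I)
  let ?I = "rel_ideal A R"
  have r: "ring (A Quot ?I)" by (rule I.quotient_is_ring)
  have Isc: "c \<odot>\<^bsub>A\<^esub> a \<in> ?I" if "a \<in> ?I" for c a
    using I.I_l_closed[OF that smult_closed[of "\<one>\<^bsub>A\<^esub>" c]] smult_mult_left[of "\<one>\<^bsub>A\<^esub>" a c] I.Icarr[OF that] by simp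
  have sm: "(\<Union>a\<in>?I +>\<^bsub>A\<^esub> x. ?I +>\<^bsub>A\<^esub> (c \<odot>\<^bsub>A\<^esub> a)) = ?I +>\<^bsub>A\<^esub> (c \<odot>\<^bsub>A\<^esub> x)" if x: "x \<in> carrier A" for x c
  proof -
    have "?I +>\<^bsub>A\<^esub> (c \<odot>\<^bsub>A\<^esub> a) = ?I +>\<^bsub>A\<^esub> (c \<odot>\<^bsub>A\<^esub> x)" if "a \<in> ?I +>\<^bsub>A\<^esub> x" for a
    proof -
      from that obtain h where h: "h \<in> ?I" "a = h \<oplus>\<^bsub>A\<^esub> x" by (auto simp: a_r_coset_def')
      have "c \<odot>\<^bsub>A\<^esub> a = (c \<odot>\<^bsub>A\<^esub> h) \<oplus>\<^bsub>A\<^esub> (c \<odot>\<^bsub>A\<^esub> x)" using h x I.Icarr smult_add_right by auto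
      then have "c \<odot>\<^bsub>A\<^esub> a \<in> ?I +>\<^bsub>A\<^esub> (c \<odot>\<^bsub>A\<^esub> x)" using Isc[OF h(1)] by (auto simp: a_r_coset_def')
      then show ?thesis using a_repr_independence I.a_subgroup x smult_closed by metis
    qed
    moreover have "x \<in> ?I +>\<^bsub>A\<^esub> x" by (rule I.a_rcos_self[OF x])
    ultimately show ?thesis by blast
  qed
  have eqs: "carrier (quot_alg A R) = carrier (A Quot ?I)" "monoid.mult (quot_alg A R) = monoid.mult (A Quot ?I)"
    "one (quot_alg A R) = one (A Quot ?I)" "zero (quot_alg A R) = zero (A Quot ?I)" "ring.add (quot_alg A R) = ring.add (A Quot ?I)"
    by (simp_all add: quot_alg_def Let_def)
  have ring: "ring (quot_alg A R)"
  proof -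
    interpret Q: ring "A Quot ?I" by (rule r)
    show ?thesis
    proof (intro ringI abelian_groupI monoidI)
      show "\<exists>y\<in>carrier (quot_alg A R). y \<oplus>\<^bsub>quot_alg A R\<^esub> x = \<zero>\<^bsub>quot_alg A R\<^esub>" if "x \<in> carrier (quot_alg A R)" for x
        using that unfolding eqs by (meson Q.a_inv_closed Q.l_neg)
      show "x \<oplus>\<^bsub>quot_alg A R\<^esub> y = y \<oplus>\<^bsub>quot_alg A R\<^esub> x" if "x \<in> carrier (quot_alg A R)" "y \<in> carrier (quot_alg A R)" for x y
        using that unfolding eqs by (rule Q.a_comm)
    qed (auto simp: eqs Q.m_assoc Q.a_assoc Q.l_distr Q.r_distr)
  qed
  have sc: "c \<odot>\<^bsub>quot_alg A R\<^esub> (?I +>\<^bsub>A\<^esub> x) = ?I +>\<^bsub>A\<^esub> (c \<odot>\<^bsub>A\<^esub> x)" if "x \<in> carrier A" for c x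
    using sm[OF that] by (simp add: quot_alg_def Let_def)
  have car: "X \<in> carrier (quot_alg A R) \<longleftrightarrow> (\<exists>x\<in>carrier A. X = ?I +>\<^bsub>A\<^esub> x)" for X
    by (auto simp: eqs FactRing_def A_RCOSETS_def')
  have mm: "(?I +>\<^bsub>A\<^esub> x) \<otimes>\<^bsub>quot_alg A R\<^esub> (?I +>\<^bsub>A\<^esub> y) = ?I +>\<^bsub>A\<^esub> (x \<otimes>\<^bsub>A\<^esub> y)"  
     "(?I +>\<^bsub>A\<^esub> x) \<oplus>\<^bsub>quot_alg A R\<^esub> (?I +>\<^bsub>A\<^esub> y) = ?I +>\<^bsub>A\<^esub> (x \<oplus>\<^bsub>A\<^esub> y)" if "x \<in> carrier A" "y \<in> carrier A" for x y
    using that by (simp_all add: eqs FactRing_def I.rcoset_mult_add I.a_rcos_sum)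
  show ?thesis
    apply (intro complex_algebra.intro ring complex_algebra_axioms.intro)
    unfolding car
    by (auto simp: sc mm smult_closed smult_add_left smult_add_right smult_smult smult_one smult_mult_left smult_mult_right)
qed

lemma quot_proj_closed:
  assumes "complex_algebra A" "R \<subseteq> carrier A \<times> carrier A" "a \<in> carrier A"
  shows "quot_proj A R a \<in> carrier (quot_alg A R)"
  using assms(3) by (auto simp: quot_alg_def Let_def quot_proj_def FactRing_def A_RCOSETS_def')

lemma complex_algebra_free: "complex_algebra (free_algebra V)"
  unfolding free_algebra_def
  by (intro complex_algebra_ma monoidI) (auto simp: free_monoid_def)

lemma free_gen_closed: "x \<in> V \<Longrightarrow> free_gen x \<in> carrier (free_algebra V)"
  by (simp add: free_algebra_def free_gen_def basis_elt_def ma_simps free_monoid_def)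

lemma hom_relations_closed:
  assumes "complex_algebra A" "complex_algebra F" "\<And>a. a \<in> carrier A \<Longrightarrow> \<iota> a \<in> carrier F"
  shows "hom_relations A F \<iota> \<subseteq> carrier F \<times> carrier F"
proof -
  interpret A: complex_algebra A by fact
  interpret F: complex_algebra F by fact
  show ?thesis using assms(3) A.smult_closed F.smult_closed by (auto simp: hom_relations_def)
qed

lemma fprod_relations_closed:
  assumes "complex_algebra A" "complex_algebra B"
  shows "fprod_relations A B \<subseteq> carrier (fprod_free A B) \<times> carrier (fprod_free A B)"
proof -
  have F: "complex_algebra (fprod_free A B)"
    unfolding fprod_free_def by (rule complex_algebra_free)
  show ?thesis
    unfolding fprod_relations_def using F assms
    by (intro Un_least hom_relations_closed) (auto simp: fprod_free_def intro!: free_gen_closed)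
qed

lemma
  assumes A: "complex_algebra A"
  shows complex_algebra_adjoin: "complex_algebra (adjoin A V)"
    and adj_base_closed: "a \<in> carrier A \<Longrightarrow> adj_base A V a \<in> carrier (adjoin A V)"
    and adj_gen_closed: "x \<in> V \<Longrightarrow> adj_gen A V x \<in> carrier (adjoin A V)"
proof -
  let ?B = "free_algebra V"
  have B: "complex_algebra ?B" by (rule complex_algebra_free)
  have F: "complex_algebra (fprod_free A ?B)" unfolding fprod_free_def by (rule complex_algebra_free)
  note R = fprod_relations_closed[OF A B]
  show "complex_algebra (adjoin A V)"
    unfolding adjoin_def free_product_def by (rule complex_algebra_quot[OF F R])
  show "adj_base A V a \<in> carrier (adjoin A V)" if "a \<in> carrier A"
    unfolding adjoin_def free_product_def adj_base_def fprod_inl_def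
    using that by (intro quot_proj_closed F R) (auto simp: fprod_free_def intro!: free_gen_closed)
  show "adj_gen A V x \<in> carrier (adjoin A V)" if "x \<in> V"
    unfolding adjoin_def free_product_def adj_gen_def fprod_inr_def
    using that by (intro quot_proj_closed F R) (auto simp: fprod_free_def intro!: free_gen_closed)
qed

lemma complex_algebra_CG: "complex_algebra (CG m n)"
  unfolding CG_def by (intro complex_algebra_ma group.is_monoid group_G)

lemma basis_elt_closed: "x \<in> carrier (G_grp m n) \<Longrightarrow> basis_elt x \<in> carrier (CG m n)"
  by (simp add: CG_def basis_elt_def ma_simps)

lemma eps_closed:
  assumes "m \<ge> 1" shows "eps m n i j \<in> carrier (CG m n)"
proof -
  interpret G: group "G_grp m n" by (rule group_G)
  interpret C: complex_algebra "CG m n" by (rule complex_algebra_CG)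
  have "(\<Sum>l\<in>L. basis_elt (x l)) \<in> carrier (CG m n)"
    if "\<And>l. x l \<in> carrier (G_grp m n)" for L :: "nat set" and x
  proof (induct L rule: infinite_finite_induct)
    case (insert l L)
    have "basis_elt (x l) \<oplus>\<^bsub>CG m n\<^esub> (\<Sum>l\<in>L. basis_elt (x l)) \<in> carrier (CG m n)"
      using insert basis_elt_closed[OF that] by (intro C.a_closed)
    then show ?case using insert by (simp add: CG_def ma_simps)
  qed (simp_all add: CG_def ma_simps)
  then show ?thesis
    unfolding eps_def using g_elt_closed[OF assms] by (simp add: G.int_pow_closed)
qed

lemma DO_relations_closed:
  assumes m: "m \<ge> 1"
  shows "DO_relations m n k \<subseteq> carrier (CG_free m n) \<times> carrier (CG_free m n)"
proof -
  interpret F: complex_algebra "CG_free m n"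
    by (intro complex_algebra_adjoin complex_algebra_CG)
  note C = complex_algebra_CG
  have z: "Z_in m n i \<in> carrier (CG_free m n)" if "i \<in> {1..n}" for i
    by (rule adj_gen_closed[OF C that])
  have g: "G_in m n (g_elt m n i) \<in> carrier (CG_free m n)" for i
    by (intro adj_base_closed C basis_elt_closed g_elt_closed m)
  have s: "G_in m n (s_elt m n i) \<in> carrier (CG_free m n)" if "i \<in> {1..<n}" for i
    by (intro adj_base_closed C basis_elt_closed s_elt_closed that)
  have e: "CG_in m n (eps m n i j) \<in> carrier (CG_free m n)" for i j
    by (intro adj_base_closed C eps_closed m)
  show ?thesis
    unfolding DO_relations_def Let_def
    apply (intro Un_least subsetI; elim CollectE exE conjE; hypsubst)
       apply (intro SigmaI F.m_closed z; assumption)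
      apply (intro SigmaI F.m_closed z g; assumption)
     apply (intro SigmaI F.m_closed z s; assumption)
    apply (intro SigmaI F.m_closed F.minus_closed F.smult_closed z s e; simp)
    done
qed

lemma tilde_relations_closed:
  assumes m: "m \<ge> 1"
    and p: "\<And>i j. i \<in> {1..n} \<Longrightarrow> j \<in> {1..n} \<Longrightarrow> p i j \<in> carrier (CG m n)"
  shows "tilde_relations m n p \<subseteq> carrier (CG_free m n) \<times> carrier (CG_free m n)"
proof -
  interpret G: group "G_grp m n" by (rule group_G)
  interpret F: complex_algebra "CG_free m n"
    by (intro complex_algebra_adjoin complex_algebra_CG)
  note C = complex_algebra_CG
  have z: "Z_in m n i \<in> carrier (CG_free m n)" if "i \<in> {1..n}" for i
    by (rule adj_gen_closed[OF C that])
  have tr: "transpose i (i + 1) j \<in> {1..n}" if "i \<in> {1..<n}" "j \<in> {1..n}" for i j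
    using that by (auto simp: transpose_def)
  have g: "G_in m n (g_elt m n i) \<in> carrier (CG_free m n)" for i
    by (intro adj_base_closed C basis_elt_closed g_elt_closed m)
  have s: "G_in m n (s_elt m n i) \<in> carrier (CG_free m n)"
    "G_in m n (inv\<^bsub>G_grp m n\<^esub> (s_elt m n i)) \<in> carrier (CG_free m n)" if "i \<in> {1..<n}" for i
    by (intro adj_base_closed C basis_elt_closed G.inv_closed s_elt_closed that)+
  have q: "CG_in m n (p i j) \<in> carrier (CG_free m n)" if "i \<in> {1..n}" "j \<in> {1..n}" for i j
    by (intro adj_base_closed C p that)
  show ?thesis
    unfolding tilde_relations_def Let_def
    apply (intro Un_least subsetI; elim CollectE exE conjE; hypsubst)
      apply (intro SigmaI F.m_closed s z tr; assumption)
     apply (intro SigmaI F.m_closed z g; assumption)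
    apply (intro SigmaI F.m_closed F.minus_closed z q; assumption)
    done
qed

lemma complex_algebra_H_DO: "m \<ge> 1 \<Longrightarrow> complex_algebra (H_DO m n k)"
  unfolding H_DO_def
  by (intro complex_algebra_quot complex_algebra_adjoin complex_algebra_CG DO_relations_closed)

end

theory Submission
  imports Defs
begin

text \<open>
  Write \<open>e\<^sub>i\<^sub>j = s\<^sub>i\<^sub>j \<epsilon>\<^sub>i\<^sub>j\<close> for the sum of the \<open>m\<close> reflections of \<open>G(m,1,n)\<close> above the transposition of
  \<open>i\<close> and \<open>j\<close>. It is symmetric in \<open>i\<close> and \<open>j\<close>, and conjugation by \<open>g \<in> G\<close> with underlying permutation \<open>w\<close>
  sends \<open>e\<^sub>i\<^sub>j\<close> to \<open>e\<^sub>w\<^sub>i\<^sub>,\<^sub>w\<^sub>j\<close>. Put \<open>D\<^sub>i = (k/2) (\<Sum>\<^sub>j\<^sub>>\<^sub>i e\<^sub>i\<^sub>j - \<Sum>\<^sub>j\<^sub><\<^sub>i e\<^sub>i\<^sub>j)\<close>, an element of the group algebra, and take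
  \<open>z\<^sub>i + D\<^sub>i\<close> as the new generators.

  The elements \<open>D\<^sub>i\<close> commute with the torus, and they satisfy \<open>D\<^sub>i s\<^sub>i = s\<^sub>i D\<^sub>i\<^sub>+\<^sub>1 + k \<epsilon>\<^sub>i\<^sub>,\<^sub>i\<^sub>+\<^sub>1\<close>, because \<open>s\<^sub>i\<close> preserves
  the order of every pair of indices but \<open>{i, i + 1}\<close> (lemma \<open>corr_s\<close>). Adding \<open>D\<^sub>i\<close> therefore
  cancels the defect \<open>- k \<epsilon>\<^sub>i\<^sub>,\<^sub>i\<^sub>+\<^sub>1\<close> in the Dunkl-Opdam relation: the relations between \<open>z\<close> and \<open>G\<close> hold
  if and only if the elements \<open>y\<^sub>i = z\<^sub>i + D\<^sub>i\<close> are permuted by \<open>S\<^sub>n\<close> and centralised by the torus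
  (\<open>dunkl_opdam_iff_covariant\<close>).

  If \<open>y\<close> is such a system, then \<open>y\<^sub>i e\<^sub>i\<^sub>j = e\<^sub>i\<^sub>j y\<^sub>j\<close>, while \<open>y\<^sub>i\<close> commutes with \<open>e\<^sub>j\<^sub>l\<close> if \<open>j\<close> and
  \<open>l\<close> differ from \<open>i\<close>. The
  coefficients of \<open>e\<^sub>i\<^sub>j\<close> in \<open>D\<^sub>i\<close> and \<open>D\<^sub>j\<close> are opposite, and this makes the mixed terms
  \<open>[y\<^sub>i, D\<^sub>j] + [D\<^sub>i, y\<^sub>j]\<close> vanish (\<open>cross_terms\<close>). So \<open>[z\<^sub>i, z\<^sub>j] = [y\<^sub>i, y\<^sub>j] + [D\<^sub>i, D\<^sub>j]\<close>, and the \<open>z\<^sub>i\<close>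
  commute if and only if \<open>[y\<^sub>i, y\<^sub>j] = [D\<^sub>j, D\<^sub>i]\<close>, which is the choice of \<open>p\<^sub>i\<^sub>j\<close>.

  These equivalences hold in every algebra that receives a homomorphism from \<open>\<complex>[G]\<close>. Hence the substitutions \<open>z\<^sub>i \<mapsto> z\<^sub>i + D\<^sub>i\<close> and
  \<open>z\<^sub>i \<mapsto> z\<^sub>i - D\<^sub>i\<close> carry each of the two presentations into the other (\<open>presented_by_translate\<close>).
\<close>

section \<open>Homomorphisms and universal properties\<close>

definition alg_hom :: "'a calg \<Rightarrow> 'b calg \<Rightarrow> ('a \<Rightarrow> 'b) set" where
  "alg_hom A B = {h \<in> ring_hom A B. \<forall>c. \<forall>a\<in>carrier A. h (c \<odot>\<^bsub>A\<^esub> a) = c \<odot>\<^bsub>B\<^esub> h a}"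

lemma alg_homI:
  assumes "\<And>a. a \<in> carrier A \<Longrightarrow> h a \<in> carrier B"
    and "\<And>a b. \<lbrakk>a \<in> carrier A; b \<in> carrier A\<rbrakk> \<Longrightarrow> h (a \<oplus>\<^bsub>A\<^esub> b) = h a \<oplus>\<^bsub>B\<^esub> h b"
    and "\<And>a b. \<lbrakk>a \<in> carrier A; b \<in> carrier A\<rbrakk> \<Longrightarrow> h (a \<otimes>\<^bsub>A\<^esub> b) = h a \<otimes>\<^bsub>B\<^esub> h b"
    and "h \<one>\<^bsub>A\<^esub> = \<one>\<^bsub>B\<^esub>"
    and "\<And>c a. a \<in> carrier A \<Longrightarrow> h (c \<odot>\<^bsub>A\<^esub> a) = c \<odot>\<^bsub>B\<^esub> h a"
  shows "h \<in> alg_hom A B"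
  using assms by (auto simp: alg_hom_def ring_hom_def)

lemma
  assumes "h \<in> alg_hom A B"
  shows alg_hom_closed: "a \<in> carrier A \<Longrightarrow> h a \<in> carrier B"
    and alg_hom_add: "\<lbrakk>a \<in> carrier A; b \<in> carrier A\<rbrakk> \<Longrightarrow> h (a \<oplus>\<^bsub>A\<^esub> b) = h a \<oplus>\<^bsub>B\<^esub> h b"
    and alg_hom_mult: "\<lbrakk>a \<in> carrier A; b \<in> carrier A\<rbrakk> \<Longrightarrow> h (a \<otimes>\<^bsub>A\<^esub> b) = h a \<otimes>\<^bsub>B\<^esub> h b"
    and alg_hom_one: "h \<one>\<^bsub>A\<^esub> = \<one>\<^bsub>B\<^esub>"
    and alg_hom_smult: "a \<in> carrier A \<Longrightarrow> h (c \<odot>\<^bsub>A\<^esub> a) = c \<odot>\<^bsub>B\<^esub> h a"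
  using assms by (auto simp: alg_hom_def ring_hom_def)

lemma alg_hom_minus:
  assumes "ring A" "ring B" "h \<in> alg_hom A B" "a \<in> carrier A" "b \<in> carrier A"
  shows "h (a \<ominus>\<^bsub>A\<^esub> b) = h a \<ominus>\<^bsub>B\<^esub> h b"
proof -
  interpret ring_hom_ring A B h
    using assms by (intro ring_hom_ringI2) (auto simp: alg_hom_def)
  show ?thesis using assms by (simp add: a_minus_def)
qed

lemma alg_hom_comp:
  assumes "h \<in> alg_hom A B" "h' \<in> alg_hom B C" shows "(\<lambda>a. h' (h a)) \<in> alg_hom A C"
  using assms by (intro alg_homI) (auto simp: alg_hom_closed alg_hom_add alg_hom_mult alg_hom_one alg_hom_smult)

lemma alg_hom_id: "(\<lambda>a. a) \<in> alg_hom A A"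
  by (rule alg_homI) auto

lemma alg_isoI:
  assumes "h \<in> alg_hom A B" "h' \<in> alg_hom B A"
    and "\<And>a. a \<in> carrier A \<Longrightarrow> h' (h a) = a" "\<And>b. b \<in> carrier B \<Longrightarrow> h (h' b) = b"
  shows "h \<in> alg_iso A B"
proof -
  have "bij_betw h (carrier A) (carrier B)"
    using assms by (intro bij_betw_byWitness[where f' = h']) (auto dest: alg_hom_closed)
  then show ?thesis using assms(1) by (auto simp: alg_iso_def alg_hom_def ring_iso_def)
qed


subsection \<open>Quotients\<close>

context
  fixes A :: "'a calg" and R :: "('a \<times> 'a) set"
  assumes A: "complex_algebra A" and R: "R \<subseteq> carrier A \<times> carrier A"
begin

interpretation complex_algebra A by (rule A)

lemma rel_ideal_ideal: "ideal (rel_ideal A R) A"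
  unfolding rel_ideal_def using R by (intro genideal_ideal) auto

interpretation I: ideal "rel_ideal A R" A by (rule rel_ideal_ideal)

lemma quot_proj_eq_iff:
  assumes "a \<in> carrier A" "b \<in> carrier A"
  shows "quot_proj A R a = quot_proj A R b \<longleftrightarrow> a \<ominus>\<^bsub>A\<^esub> b \<in> rel_ideal A R"
  unfolding quot_proj_def using quotient_eq_iff_same_a_r_cos[OF rel_ideal_ideal] assms by blast

lemma quot_carrier: "carrier (quot_alg A R) = quot_proj A R ` carrier A"
  by (auto simp: quot_alg_def Let_def quot_proj_def FactRing_def A_RCOSETS_def')

lemma quot_proj_hom: "quot_proj A R \<in> alg_hom A (quot_alg A R)"
proof (rule alg_homI)
  fix c a assume a: "a \<in> carrier A"
  have "quot_proj A R (c \<odot>\<^bsub>A\<^esub> x) = quot_proj A R (c \<odot>\<^bsub>A\<^esub> a)" if x: "x \<in> quot_proj A R a" for x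
  proof -
    obtain h where h: "h \<in> rel_ideal A R" and xh: "x = h \<oplus>\<^bsub>A\<^esub> a"
      using x by (auto simp: quot_proj_def a_r_coset_def')
    have hc: "h \<in> carrier A" by (rule I.Icarr[OF h])
    \<comment> \<open>A two-sided ideal absorbs scalars, since scaling is multiplication by \<open>c\<close> times the unit.\<close>
    have "c \<odot>\<^bsub>A\<^esub> x \<ominus>\<^bsub>A\<^esub> c \<odot>\<^bsub>A\<^esub> a = c \<odot>\<^bsub>A\<^esub> h"
      using smult_closed[OF hc, of c] smult_closed[OF a, of c]
      by (simp add: xh smult_add_right[OF hc a] a_minus_def a_assoc r_neg)
    also have "\<dots> = (c \<odot>\<^bsub>A\<^esub> \<one>\<^bsub>A\<^esub>) \<otimes>\<^bsub>A\<^esub> h"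
      using smult_mult_left[of "\<one>\<^bsub>A\<^esub>" h c] hc by simp
    also have "\<dots> \<in> rel_ideal A R"
      by (intro I.I_l_closed h smult_closed one_closed)
    finally show ?thesis using a hc xh by (simp add: quot_proj_eq_iff smult_closed)
  qed
  moreover have "a \<in> quot_proj A R a" unfolding quot_proj_def by (rule I.a_rcos_self[OF a])
  ultimately have "(\<Union>x\<in>quot_proj A R a. quot_proj A R (c \<odot>\<^bsub>A\<^esub> x)) = quot_proj A R (c \<odot>\<^bsub>A\<^esub> a)"
    by blast
  then show "quot_proj A R (c \<odot>\<^bsub>A\<^esub> a) = c \<odot>\<^bsub>quot_alg A R\<^esub> quot_proj A R a"
    by (simp add: quot_alg_def Let_def quot_proj_def)
qed (auto simp: quot_carrier, auto simp: quot_alg_def Let_def quot_proj_def FactRing_def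
        I.rcoset_mult_add I.a_rcos_sum)

lemma quot_proj_rel: "(l, r) \<in> R \<Longrightarrow> quot_proj A R l = quot_proj A R r"
  using R by (subst quot_proj_eq_iff) (auto simp: rel_ideal_def intro!: genideal_self[THEN subsetD])

lemma quot_hom_lift:
  assumes B: "complex_algebra B" and h: "h \<in> alg_hom A B"
    and hR: "\<And>l r. (l, r) \<in> R \<Longrightarrow> h l = h r"
  shows "\<exists>h' \<in> alg_hom (quot_alg A R) B. \<forall>a\<in>carrier A. h' (quot_proj A R a) = h a"
proof -
  interpret B: complex_algebra B by (rule B)
  interpret h: ring_hom_ring A B h
    using h ring_axioms B.ring_axioms by (intro ring_hom_ringI2) (auto simp: alg_hom_def)
  have ker: "h (l \<ominus>\<^bsub>A\<^esub> r) = \<zero>\<^bsub>B\<^esub>" if "(l, r) \<in> R" for l r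
    using that R hR[OF that] by (auto simp: a_minus_def B.r_neg)
  have "rel_ideal A R \<subseteq> a_kernel A B h"
  proof -
    have "{l \<ominus>\<^bsub>A\<^esub> r |l r. (l, r) \<in> R} \<subseteq> {x \<in> carrier A. h x = \<zero>\<^bsub>B\<^esub>}"
      using ker R by (auto intro: minus_closed)
    then show ?thesis
      unfolding rel_ideal_def
      by (intro genideal_minimal h.kernel_is_ideal) (simp only: a_kernel_def')
  qed
  then have wd: "h a = h b"
    if "a \<in> carrier A" "b \<in> carrier A" "quot_proj A R a = quot_proj A R b" for a b
  proof -
    have "h (a \<ominus>\<^bsub>A\<^esub> b) = \<zero>\<^bsub>B\<^esub>"
      using quot_proj_eq_iff[OF that(1,2)] that(3) \<open>rel_ideal A R \<subseteq> a_kernel A B h\<close>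
      unfolding a_kernel_def' by blast
    then show ?thesis
      using alg_hom_minus[OF ring_axioms B.ring_axioms h that(1,2)] that(1,2)
        B.minus_equality[of "\<ominus>\<^bsub>B\<^esub> h b" "h a"]
      unfolding a_minus_def by (metis B.a_comm B.a_inv_closed B.minus_equality B.minus_minus h.hom_closed)
  qed
  define h' where "h' X = h (inv_into (carrier A) (quot_proj A R) X)" for X
  have h': "h' (quot_proj A R a) = h a" if "a \<in> carrier A" for a
  proof -
    have "quot_proj A R a \<in> quot_proj A R ` carrier A" using that by (rule imageI)
    from inv_into_into[OF this] f_inv_into_f[OF this] show ?thesis
      unfolding h'_def using that by (intro wd)
  qed
  note q = alg_hom_add[OF quot_proj_hom, symmetric] alg_hom_mult[OF quot_proj_hom, symmetric]
     alg_hom_one[OF quot_proj_hom, symmetric] alg_hom_smult[OF quot_proj_hom, symmetric]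
  have "h' \<in> alg_hom (quot_alg A R) B"
  proof (rule alg_homI)
    show "h' \<one>\<^bsub>quot_alg A R\<^esub> = \<one>\<^bsub>B\<^esub>"
      by (simp only: q h' one_closed alg_hom_one[OF h])
  qed (unfold quot_carrier, (elim imageE; simp only: q h' a_closed m_closed smult_closed h.hom_closed
        alg_hom_add[OF h] alg_hom_mult[OF h] alg_hom_smult[OF h])+)
  with h' show ?thesis by blast
qed

end

lemma quot_hom_eq:
  assumes "complex_algebra A" "R \<subseteq> carrier A \<times> carrier A"
    and "\<And>a. a \<in> carrier A \<Longrightarrow> h (quot_proj A R a) = h' (quot_proj A R a)"
    and "X \<in> carrier (quot_alg A R)"
  shows "h X = h' X"
  using assms by (auto simp: quot_carrier)


subsection \<open>Monoid algebras and free algebras\<close>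

text \<open>
  The homomorphism is the linear extension of \<open>f\<close>; it is multiplicative because it is so on the basis
  elements and both sides are bilinear.
\<close>

lemma monoid_algebra_hom_lift:
  fixes M :: "'a monoid" and B :: "'b calg"
  assumes M: "monoid M" and B: "complex_algebra B" and f: "f \<in> hom M B" and f1: "f \<one>\<^bsub>M\<^esub> = \<one>\<^bsub>B\<^esub>"
  shows "\<exists>h \<in> alg_hom (monoid_algebra M) B. \<forall>a\<in>carrier M. h (basis_elt a) = f a"
proof -
  interpret M: monoid M by (rule M)
  interpret B: complex_algebra B by (rule B)
  interpret MA: complex_algebra "monoid_algebra M" by (rule complex_algebra_ma[OF M])
  have fc: "f a \<in> carrier B" if "a \<in> carrier M" for a using f that by (auto simp: hom_def)
  have s0: "0 \<odot>\<^bsub>B\<^esub> b = \<zero>\<^bsub>B\<^esub>" if "b \<in> carrier B" for b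
    using B.smult_add_left[OF that, of 0 0] B.smult_closed[OF that, of 0] by simp
  define h where "h p = (\<Oplus>\<^bsub>B\<^esub>a\<in>Poly_Mapping.keys p. Poly_Mapping.lookup p a \<odot>\<^bsub>B\<^esub> f a)" for p
  have tc: "c \<odot>\<^bsub>B\<^esub> f a \<in> carrier B" if "a \<in> carrier M" for a c
    using that fc B.smult_closed by blast
  have h: "h p = (\<Oplus>\<^bsub>B\<^esub>a\<in>K. Poly_Mapping.lookup p a \<odot>\<^bsub>B\<^esub> f a)"
    if "finite K" "Poly_Mapping.keys p \<subseteq> K" "K \<subseteq> carrier M" for p K
    unfolding h_def using that
    by (intro B.add.finprod_mono_neutral_cong_left) (auto simp: in_keys_iff s0 fc tc)
  have hc: "h p \<in> carrier B" if "Poly_Mapping.keys p \<subseteq> carrier M" for p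
    unfolding h_def using that by (intro B.finsum_closed) (auto simp: tc)
  have hadd: "h (p + q) = h p \<oplus>\<^bsub>B\<^esub> h q"
    if "Poly_Mapping.keys p \<subseteq> carrier M" "Poly_Mapping.keys q \<subseteq> carrier M" for p q
  proof -
    let ?K = "Poly_Mapping.keys p \<union> Poly_Mapping.keys q"
    have K: "finite ?K" "?K \<subseteq> carrier M" "Poly_Mapping.keys (p + q) \<subseteq> ?K"
      using that Poly_Mapping.keys_add[of p q] by auto
    show ?thesis
      using K that h[OF K(1) K(3) K(2)] h[of ?K p] h[of ?K q]
      by (auto simp: lookup_add B.smult_add_left fc tc subset_iff intro!: B.finsum_addf B.finsum_cong'
           trans[OF B.finsum_cong' B.finsum_addf])
  qed
  have hsingle: "h (Poly_Mapping.single a c) = c \<odot>\<^bsub>B\<^esub> f a" if "a \<in> carrier M" for a c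
    using that h[of "{a}" "Poly_Mapping.single a c"] by (simp add: tc)
  have h0: "h 0 = \<zero>\<^bsub>B\<^esub>" by (simp add: h_def)
  have ss: "Poly_Mapping.map ((*) c) (Poly_Mapping.single a d) = Poly_Mapping.single a (c * d)"
    for c d :: complex and a :: 'a
    by (rule poly_mapping_eqI) (simp add: lookup_map_scale lookup_single when_def)
  have "h \<in> alg_hom (monoid_algebra M) B"
  proof (rule alg_homI)
    fix p q assume "p \<in> carrier (monoid_algebra M)" "q \<in> carrier (monoid_algebra M)"
    then have p: "Poly_Mapping.keys p \<subseteq> carrier M" and q: "Poly_Mapping.keys q \<subseteq> carrier M"
      by (auto simp: ma_simps)
    show "h (p \<oplus>\<^bsub>monoid_algebra M\<^esub> q) = h p \<oplus>\<^bsub>B\<^esub> h q" by (simp add: ma_simps hadd p q)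
    have "Poly_Mapping.keys p \<subseteq> carrier M \<and> h (p \<otimes>\<^bsub>monoid_algebra M\<^esub> q) = h p \<otimes>\<^bsub>B\<^esub> h q"
    proof (rule ma_induct[OF p])
      fix a c assume a: "a \<in> carrier M"
      have "Poly_Mapping.keys q \<subseteq> carrier M \<and>
         h (Poly_Mapping.single a c \<otimes>\<^bsub>monoid_algebra M\<^esub> q) = h (Poly_Mapping.single a c) \<otimes>\<^bsub>B\<^esub> h q"
      proof (rule ma_induct[OF q])
        fix b d assume b: "b \<in> carrier M"
        have "f (a \<otimes>\<^bsub>M\<^esub> b) = f a \<otimes>\<^bsub>B\<^esub> f b" using f a b by (auto simp: hom_def)
        then show "Poly_Mapping.keys (Poly_Mapping.single b d) \<subseteq> carrier M \<and>
          h (Poly_Mapping.single a c \<otimes>\<^bsub>monoid_algebra M\<^esub> Poly_Mapping.single b d)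
            = h (Poly_Mapping.single a c) \<otimes>\<^bsub>B\<^esub> h (Poly_Mapping.single b d)"
          using a b by (simp add: ma_mult_single hsingle B.smult_mult_left B.smult_mult_right fc tc
              B.smult_smult[symmetric] mult.commute)
      next
        fix g g'
        assume g: "Poly_Mapping.keys g \<subseteq> carrier M \<and>
            h (Poly_Mapping.single a c \<otimes>\<^bsub>monoid_algebra M\<^esub> g) = h (Poly_Mapping.single a c) \<otimes>\<^bsub>B\<^esub> h g"
          and g': "Poly_Mapping.keys g' \<subseteq> carrier M \<and>
            h (Poly_Mapping.single a c \<otimes>\<^bsub>monoid_algebra M\<^esub> g') = h (Poly_Mapping.single a c) \<otimes>\<^bsub>B\<^esub> h g'"
        have "Poly_Mapping.keys (Poly_Mapping.single a c \<otimes>\<^bsub>monoid_algebra M\<^esub> x) \<subseteq> carrier M"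
          if "Poly_Mapping.keys x \<subseteq> carrier M" for x
          using MA.m_closed[of "Poly_Mapping.single a c" x] a that by (auto simp: ma_simps)
        then show "Poly_Mapping.keys (g + g') \<subseteq> carrier M \<and>
            h (Poly_Mapping.single a c \<otimes>\<^bsub>monoid_algebra M\<^esub> (g + g'))
              = h (Poly_Mapping.single a c) \<otimes>\<^bsub>B\<^esub> h (g + g')"
          using g g' a Poly_Mapping.keys_add[of g g']
          by (auto simp: ma_mult_add_right hadd B.r_distr hc hsingle tc)
      qed (simp add: ma_mult_zero h0 hsingle a tc)
      then show "Poly_Mapping.keys (Poly_Mapping.single a c) \<subseteq> carrier M \<and>
         h (Poly_Mapping.single a c \<otimes>\<^bsub>monoid_algebra M\<^esub> q) = h (Poly_Mapping.single a c) \<otimes>\<^bsub>B\<^esub> h q"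
        using a by simp
    next
      fix g g'
      assume g: "Poly_Mapping.keys g \<subseteq> carrier M \<and> h (g \<otimes>\<^bsub>monoid_algebra M\<^esub> q) = h g \<otimes>\<^bsub>B\<^esub> h q"
        and g': "Poly_Mapping.keys g' \<subseteq> carrier M \<and> h (g' \<otimes>\<^bsub>monoid_algebra M\<^esub> q) = h g' \<otimes>\<^bsub>B\<^esub> h q"
      have "Poly_Mapping.keys (x \<otimes>\<^bsub>monoid_algebra M\<^esub> q) \<subseteq> carrier M"
        if "Poly_Mapping.keys x \<subseteq> carrier M" for x
        using MA.m_closed[of x q] q that by (auto simp: ma_simps)
      then show "Poly_Mapping.keys (g + g') \<subseteq> carrier M \<and>
         h ((g + g') \<otimes>\<^bsub>monoid_algebra M\<^esub> q) = h (g + g') \<otimes>\<^bsub>B\<^esub> h q"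
        using g g' q Poly_Mapping.keys_add[of g g'] by (auto simp: ma_mult_add_left hadd B.l_distr hc)
    qed (simp add: ma_mult_zero h0 hc q)
    then show "h (p \<otimes>\<^bsub>monoid_algebra M\<^esub> q) = h p \<otimes>\<^bsub>B\<^esub> h q" by blast
  next
    fix c p assume "p \<in> carrier (monoid_algebra M)"
    then have p: "Poly_Mapping.keys p \<subseteq> carrier M" by (simp add: ma_simps)
    have "Poly_Mapping.keys (Poly_Mapping.map ((*) c) p) \<subseteq> Poly_Mapping.keys p"
      by (auto simp: in_keys_iff lookup_map_scale)
    then have "h (Poly_Mapping.map ((*) c) p)
        = (\<Oplus>\<^bsub>B\<^esub>a\<in>Poly_Mapping.keys p. c \<odot>\<^bsub>B\<^esub> (Poly_Mapping.lookup p a \<odot>\<^bsub>B\<^esub> f a))"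
      using p by (subst h[of "Poly_Mapping.keys p"])
        (auto simp: lookup_map_scale B.smult_smult fc tc subset_iff B.smult_closed intro!: B.finsum_cong')
    also have "\<dots> = c \<odot>\<^bsub>B\<^esub> h p"
    proof -
      have sz: "c \<odot>\<^bsub>B\<^esub> \<zero>\<^bsub>B\<^esub> = \<zero>\<^bsub>B\<^esub>"
        using B.smult_smult[of "\<zero>\<^bsub>B\<^esub>" c 0] by (simp add: s0)
      have "(\<Oplus>\<^bsub>B\<^esub>a\<in>K. c \<odot>\<^bsub>B\<^esub> (Poly_Mapping.lookup p a \<odot>\<^bsub>B\<^esub> f a))
          = c \<odot>\<^bsub>B\<^esub> (\<Oplus>\<^bsub>B\<^esub>a\<in>K. Poly_Mapping.lookup p a \<odot>\<^bsub>B\<^esub> f a)"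
        if "finite K" "K \<subseteq> carrier M" for K
        using that
        by (induct K) (auto simp: sz tc B.smult_closed B.smult_add_right Pi_def subset_iff)
      then show ?thesis using p by (simp add: h_def)
    qed
    finally show "h (c \<odot>\<^bsub>monoid_algebra M\<^esub> p) = c \<odot>\<^bsub>B\<^esub> h p" by (simp add: ma_simps)
  qed (auto simp: ma_simps hc hsingle f1 B.smult_one)
  moreover have "h (basis_elt a) = f a" if "a \<in> carrier M" for a
    using that by (simp add: basis_elt_def hsingle B.smult_one fc)
  ultimately show ?thesis by blast
qed

lemma monoid_algebra_hom_eq:
  fixes M :: "'a monoid"
  assumes M: "monoid M" and h: "h \<in> alg_hom (monoid_algebra M) B" "h' \<in> alg_hom (monoid_algebra M) B"
    and eq: "\<And>a. a \<in> carrier M \<Longrightarrow> h (basis_elt a) = h' (basis_elt a)"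
    and p: "p \<in> carrier (monoid_algebra M)"
  shows "h p = h' p"
proof -
  interpret MA: complex_algebra "monoid_algebra M" by (rule complex_algebra_ma[OF M])
  have single: "Poly_Mapping.single a c = c \<odot>\<^bsub>monoid_algebra M\<^esub> basis_elt a" for a :: 'a and c
    unfolding ma_simps basis_elt_def
    by (rule poly_mapping_eqI) (simp add: lookup_map_scale lookup_single when_def)
  have b: "basis_elt a \<in> carrier (monoid_algebra M)" if "a \<in> carrier M" for a
    using that by (simp add: ma_simps basis_elt_def)
  have hs: "h (Poly_Mapping.single a c) = h' (Poly_Mapping.single a c)" if "a \<in> carrier M" for a c
    unfolding single using that eq b by (simp add: alg_hom_smult[OF h(1)] alg_hom_smult[OF h(2)])
  have "p \<in> carrier (monoid_algebra M) \<and> h p = h' p"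
  proof (rule ma_induct[of p "carrier M"])
    show "Poly_Mapping.keys p \<subseteq> carrier M" using p by (simp add: ma_simps)
    show "0 \<in> carrier (monoid_algebra M) \<and> h 0 = h' 0"
      using hs[OF monoid.one_closed[OF M], of 0] by (simp add: ma_simps)
    fix f g assume "f \<in> carrier (monoid_algebra M) \<and> h f = h' f"
      "g \<in> carrier (monoid_algebra M) \<and> h g = h' g"
    then show "f + g \<in> carrier (monoid_algebra M) \<and> h (f + g) = h' (f + g)"
      using alg_hom_add[OF h(1), of f g] alg_hom_add[OF h(2), of f g] MA.a_closed[of f g]
      by (simp add: ma_simps(4))
  qed (auto simp: hs ma_simps)
  then show ?thesis by blast
qed

lemma monoid_free_monoid: "monoid (free_monoid V)"
  by (intro monoidI) (auto simp: free_monoid_def)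

lemma free_algebra_hom_lift:
  assumes B: "complex_algebra B" and b: "\<And>x. x \<in> V \<Longrightarrow> b x \<in> carrier B"
  shows "\<exists>h \<in> alg_hom (free_algebra V) B. \<forall>x\<in>V. h (free_gen x) = b x"
proof -
  interpret B: complex_algebra B by (rule B)
  define f where "f xs = foldr (\<otimes>\<^bsub>B\<^esub>) (map b xs) \<one>\<^bsub>B\<^esub>" for xs
  have fc: "f xs \<in> carrier B" if "set xs \<subseteq> V" for xs
    using that by (induct xs) (auto simp: f_def b)
  have "f (xs @ ys) = f xs \<otimes>\<^bsub>B\<^esub> f ys" if "set xs \<subseteq> V" "set ys \<subseteq> V" for xs ys
    using that
  proof (induct xs)
    case (Cons x xs)
    then show ?case using fc[of xs] fc[of ys] by (simp add: f_def b B.m_assoc)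
  qed (use fc[of ys] in \<open>simp add: f_def\<close>)
  then have "f \<in> hom (free_monoid V) B"
    by (auto simp: hom_def free_monoid_def fc lists_eq_set)
  from monoid_algebra_hom_lift[OF monoid_free_monoid B this]
  obtain h where "h \<in> alg_hom (free_algebra V) B" "\<forall>xs\<in>lists V. h (basis_elt xs) = f xs"
    by (auto simp: f_def free_monoid_def free_algebra_def)
  then show ?thesis by (intro bexI[of _ h]) (auto simp: free_gen_def f_def b)
qed

lemma free_algebra_hom_eq:
  assumes h: "h \<in> alg_hom (free_algebra V) B" "h' \<in> alg_hom (free_algebra V) B"
    and eq: "\<And>x. x \<in> V \<Longrightarrow> h (free_gen x) = h' (free_gen x)"
    and p: "p \<in> carrier (free_algebra V)"
  shows "h p = h' p"
proof (rule monoid_algebra_hom_eq[OF monoid_free_monoid, of h V B h' p])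
  fix xs assume "xs \<in> carrier (free_monoid V)"
  then have "xs \<in> lists V" by (simp add: free_monoid_def)
  then show "h (basis_elt xs) = h' (basis_elt xs)"
  proof (induct xs)
    case Nil
    have "basis_elt [] = \<one>\<^bsub>free_algebra V\<^esub>"
      by (simp add: basis_elt_def free_algebra_def ma_simps free_monoid_def)
    then show ?case using alg_hom_one[OF h(1)] alg_hom_one[OF h(2)] by simp
  next
    case (Cons x xs)
    have c: "basis_elt xs \<in> carrier (free_algebra V)" "free_gen x \<in> carrier (free_algebra V)"
      using Cons free_gen_closed[of x V]
      by (auto simp: basis_elt_def free_algebra_def ma_simps free_monoid_def)
    have "basis_elt (x # xs) = free_gen x \<otimes>\<^bsub>free_algebra V\<^esub> basis_elt xs"
      by (simp add: basis_elt_def free_gen_def free_algebra_def ma_mult_single) (simp add: free_monoid_def)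
    then show ?case using Cons c eq by (simp add: alg_hom_mult[OF h(1)] alg_hom_mult[OF h(2)])
  qed
qed (use h p in \<open>simp_all add: free_algebra_def\<close>)


subsection \<open>Adjoining generators\<close>

text \<open>
  Read from left to right this shows that the inclusions into a free product are homomorphisms; from
  right to left it makes a map out of the free algebra factor through the free product.
\<close>

lemma hom_relations_respect_iff:
  assumes A: "complex_algebra A" and F: "complex_algebra F" and h: "h \<in> alg_hom F B"
    and i: "\<And>a. a \<in> carrier A \<Longrightarrow> \<iota> a \<in> carrier F"
  shows "(\<forall>(l, r) \<in> hom_relations A F \<iota>. h l = h r) \<longleftrightarrow> (\<lambda>a. h (\<iota> a)) \<in> alg_hom A B"
proof
  interpret A: complex_algebra A by fact
  assume "\<forall>(l, r) \<in> hom_relations A F \<iota>. h l = h r"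
  then have *: "h l = h r" if "(l, r) \<in> hom_relations A F \<iota>" for l r using that by blast
  show "(\<lambda>a. h (\<iota> a)) \<in> alg_hom A B"
  proof (rule alg_homI)
    show "h (\<iota> (a \<oplus>\<^bsub>A\<^esub> b)) = h (\<iota> a) \<oplus>\<^bsub>B\<^esub> h (\<iota> b)" "h (\<iota> (a \<otimes>\<^bsub>A\<^esub> b)) = h (\<iota> a) \<otimes>\<^bsub>B\<^esub> h (\<iota> b)"
      if "a \<in> carrier A" "b \<in> carrier A" for a b
    proof -
      have "(\<iota> (a \<oplus>\<^bsub>A\<^esub> b), \<iota> a \<oplus>\<^bsub>F\<^esub> \<iota> b) \<in> hom_relations A F \<iota>"
        "(\<iota> (a \<otimes>\<^bsub>A\<^esub> b), \<iota> a \<otimes>\<^bsub>F\<^esub> \<iota> b) \<in> hom_relations A F \<iota>"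
        using that unfolding hom_relations_def by blast+
      from this[THEN *] show "h (\<iota> (a \<oplus>\<^bsub>A\<^esub> b)) = h (\<iota> a) \<oplus>\<^bsub>B\<^esub> h (\<iota> b)"
        "h (\<iota> (a \<otimes>\<^bsub>A\<^esub> b)) = h (\<iota> a) \<otimes>\<^bsub>B\<^esub> h (\<iota> b)"
        by (simp_all add: that i alg_hom_add[OF h] alg_hom_mult[OF h])
    qed
    show "h (\<iota> \<one>\<^bsub>A\<^esub>) = \<one>\<^bsub>B\<^esub>"
      using *[of "\<iota> \<one>\<^bsub>A\<^esub>" "\<one>\<^bsub>F\<^esub>"] by (simp add: hom_relations_def alg_hom_one[OF h])
    show "h (\<iota> (c \<odot>\<^bsub>A\<^esub> a)) = c \<odot>\<^bsub>B\<^esub> h (\<iota> a)" if "a \<in> carrier A" for c a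
    proof -
      have "(\<iota> (c \<odot>\<^bsub>A\<^esub> a), c \<odot>\<^bsub>F\<^esub> \<iota> a) \<in> hom_relations A F \<iota>"
        using that unfolding hom_relations_def by blast
      from *[OF this] show ?thesis by (simp add: that i alg_hom_smult[OF h])
    qed
  qed (auto simp: i alg_hom_closed[OF h])
next
  assume "(\<lambda>a. h (\<iota> a)) \<in> alg_hom A B"
  note * = alg_hom_add[OF this] alg_hom_mult[OF this] alg_hom_one[OF this] alg_hom_smult[OF this]
  show "\<forall>(l, r) \<in> hom_relations A F \<iota>. h l = h r"
    unfolding hom_relations_def
    by (auto simp: * i alg_hom_add[OF h] alg_hom_mult[OF h] alg_hom_one[OF h] alg_hom_smult[OF h])
qed

context
  fixes A :: "'a calg" and B :: "'b calg"
  assumes A: "complex_algebra A" and B: "complex_algebra B"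
begin

lemma complex_algebra_fprod_free: "complex_algebra (fprod_free A B)"
  unfolding fprod_free_def by (rule complex_algebra_free)

lemma fprod_gen_closed:
  "a \<in> carrier A \<Longrightarrow> free_gen (Inl a) \<in> carrier (fprod_free A B)"
  "b \<in> carrier B \<Longrightarrow> free_gen (Inr b) \<in> carrier (fprod_free A B)"
  by (auto simp: fprod_free_def intro!: free_gen_closed)

lemma fprod_incl_hom:
  "fprod_inl A B \<in> alg_hom A (free_product A B)" "fprod_inr A B \<in> alg_hom B (free_product A B)"
proof -
  note R = fprod_relations_closed[OF A B]
  have p: "quot_proj (fprod_free A B) (fprod_relations A B) \<in> alg_hom (fprod_free A B) (free_product A B)"
    unfolding free_product_def by (rule quot_proj_hom[OF complex_algebra_fprod_free R])
  let ?q = "quot_proj (fprod_free A B) (fprod_relations A B)"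
  have "?q l = ?q r" if "(l, r) \<in> hom_relations A (fprod_free A B) (\<lambda>a. free_gen (Inl a))" for l r
    by (rule quot_proj_rel[OF complex_algebra_fprod_free R]) (use that in \<open>simp add: fprod_relations_def\<close>)
  moreover
  have "?q l = ?q r" if "(l, r) \<in> hom_relations B (fprod_free A B) (\<lambda>b. free_gen (Inr b))" for l r
    by (rule quot_proj_rel[OF complex_algebra_fprod_free R]) (use that in \<open>simp add: fprod_relations_def\<close>)
  ultimately have
    "\<forall>(l, r) \<in> hom_relations A (fprod_free A B) (\<lambda>a. free_gen (Inl a)). ?q l = ?q r"
    "\<forall>(l, r) \<in> hom_relations B (fprod_free A B) (\<lambda>b. free_gen (Inr b)). ?q l = ?q r"
    by blast+
  then show "fprod_inl A B \<in> alg_hom A (free_product A B)" "fprod_inr A B \<in> alg_hom B (free_product A B)"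
    unfolding fprod_inl_def[abs_def] fprod_inr_def[abs_def]
    by (simp_all only: hom_relations_respect_iff[OF A complex_algebra_fprod_free p fprod_gen_closed(1)]
      hom_relations_respect_iff[OF B complex_algebra_fprod_free p fprod_gen_closed(2)])
qed

lemma fprod_hom_lift:
  assumes C: "complex_algebra C" and f: "f \<in> alg_hom A C" and g: "g \<in> alg_hom B C"
  shows "\<exists>h \<in> alg_hom (free_product A B) C.
    (\<forall>a\<in>carrier A. h (fprod_inl A B a) = f a) \<and> (\<forall>b\<in>carrier B. h (fprod_inr A B b) = g b)"
proof -
  note R = fprod_relations_closed[OF A B]
  interpret A: complex_algebra A by (rule A)
  interpret B: complex_algebra B by (rule B)
  have "\<exists>h \<in> alg_hom (fprod_free A B) C. \<forall>x\<in>carrier A <+> carrier B. h (free_gen x) = case_sum f g x"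
    unfolding fprod_free_def using alg_hom_closed[OF f] alg_hom_closed[OF g]
    by (intro free_algebra_hom_lift C) auto
  then obtain h where h: "h \<in> alg_hom (fprod_free A B) C"
    and hs: "\<forall>x\<in>carrier A <+> carrier B. h (free_gen x) = case_sum f g x"
    by blast
  have hA: "h (free_gen (Inl a)) = f a" if "a \<in> carrier A" for a
    using bspec[OF hs, of "Inl a"] that by auto
  have hB: "h (free_gen (Inr b)) = g b" if "b \<in> carrier B" for b
    using bspec[OF hs, of "Inr b"] that by auto
  have "(\<lambda>a. h (free_gen (Inl a))) \<in> alg_hom A C"
    by (rule alg_homI) (auto simp: hA A.smult_closed alg_hom_closed[OF f] alg_hom_add[OF f]
       alg_hom_mult[OF f] alg_hom_one[OF f] alg_hom_smult[OF f])
  moreover have "(\<lambda>b. h (free_gen (Inr b))) \<in> alg_hom B C"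
    by (rule alg_homI) (auto simp: hB B.smult_closed alg_hom_closed[OF g] alg_hom_add[OF g]
       alg_hom_mult[OF g] alg_hom_one[OF g] alg_hom_smult[OF g])
  ultimately have "h l = h r" if "(l, r) \<in> fprod_relations A B" for l r
    using that hom_relations_respect_iff[OF A complex_algebra_fprod_free h, of "\<lambda>a. free_gen (Inl a)"]
      hom_relations_respect_iff[OF B complex_algebra_fprod_free h, of "\<lambda>b. free_gen (Inr b)"]
      fprod_gen_closed by (auto simp: fprod_relations_def)
  from quot_hom_lift[OF complex_algebra_fprod_free R C h this]
  obtain h' where "h' \<in> alg_hom (free_product A B) C"
    "\<And>x. x \<in> carrier (fprod_free A B) \<Longrightarrow>
      h' (quot_proj (fprod_free A B) (fprod_relations A B) x) = h x"
    by (auto simp: free_product_def)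
  then show ?thesis
    by (intro bexI[of _ h']) (auto simp: fprod_inl_def fprod_inr_def fprod_gen_closed hA hB)
qed

lemma fprod_hom_eq:
  assumes h: "h \<in> alg_hom (free_product A B) C" "h' \<in> alg_hom (free_product A B) C"
    and eqA: "\<And>a. a \<in> carrier A \<Longrightarrow> h (fprod_inl A B a) = h' (fprod_inl A B a)"
    and eqB: "\<And>b. b \<in> carrier B \<Longrightarrow> h (fprod_inr A B b) = h' (fprod_inr A B b)"
    and X: "X \<in> carrier (free_product A B)"
  shows "h X = h' X"
proof -
  note R = fprod_relations_closed[OF A B]
  let ?q = "quot_proj (fprod_free A B) (fprod_relations A B)"
  have p: "?q \<in> alg_hom (fprod_free A B) (free_product A B)"
    unfolding free_product_def by (rule quot_proj_hom[OF complex_algebra_fprod_free R])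
  note hq = alg_hom_comp[OF p h(1)] alg_hom_comp[OF p h(2)]
  have "h (?q a) = h' (?q a)" if "a \<in> carrier (fprod_free A B)" for a
    using free_algebra_hom_eq[OF hq[unfolded fprod_free_def] _ that[unfolded fprod_free_def]]
      eqA eqB unfolding fprod_inl_def fprod_inr_def fprod_free_def by blast
  then show ?thesis
    by (rule quot_hom_eq[OF complex_algebra_fprod_free R _ X[unfolded free_product_def]])
qed

end

lemma adj_base_hom: "complex_algebra A \<Longrightarrow> adj_base A V \<in> alg_hom A (adjoin A V)"
  unfolding adj_base_def adjoin_def by (intro fprod_incl_hom complex_algebra_free)

lemma adjoin_hom_lift:
  assumes A: "complex_algebra A" and B: "complex_algebra B" and f: "f \<in> alg_hom A B"
    and b: "\<And>x. x \<in> V \<Longrightarrow> b x \<in> carrier B"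
  shows "\<exists>h \<in> alg_hom (adjoin A V) B.
    (\<forall>a\<in>carrier A. h (adj_base A V a) = f a) \<and> (\<forall>x\<in>V. h (adj_gen A V x) = b x)"
proof -
  obtain g where g: "g \<in> alg_hom (free_algebra V) B" "\<And>x. x \<in> V \<Longrightarrow> g (free_gen x) = b x"
    using free_algebra_hom_lift[of B V b] B b by blast
  from fprod_hom_lift[OF A complex_algebra_free B f g(1)] show ?thesis
    unfolding adjoin_def adj_base_def adj_gen_def using g(2) by (metis free_gen_closed)
qed

lemma adjoin_hom_eq:
  assumes A: "complex_algebra A" and h: "h \<in> alg_hom (adjoin A V) B" "h' \<in> alg_hom (adjoin A V) B"
    and eqA: "\<And>a. a \<in> carrier A \<Longrightarrow> h (adj_base A V a) = h' (adj_base A V a)"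
    and eqV: "\<And>x. x \<in> V \<Longrightarrow> h (adj_gen A V x) = h' (adj_gen A V x)"
    and X: "X \<in> carrier (adjoin A V)"
  shows "h X = h' X"
proof (rule fprod_hom_eq[OF A complex_algebra_free])
  show "h \<in> alg_hom (free_product A (free_algebra V)) B" "h' \<in> alg_hom (free_product A (free_algebra V)) B"
    "X \<in> carrier (free_product A (free_algebra V))"
    using h X by (simp_all add: adjoin_def)
  show "h (fprod_inl A (free_algebra V) a) = h' (fprod_inl A (free_algebra V) a)" if "a \<in> carrier A" for a
    using eqA[OF that] by (simp add: adj_base_def)
  note i = fprod_incl_hom(2)[OF A complex_algebra_free, of V]
  show "h (fprod_inr A (free_algebra V) p) = h' (fprod_inr A (free_algebra V) p)"
    if "p \<in> carrier (free_algebra V)" for p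
    using free_algebra_hom_eq[OF alg_hom_comp[OF i] alg_hom_comp[OF i], of h B h' p] that h eqV
    by (simp add: adjoin_def adj_gen_def)
qed


subsection \<open>Recognising presentations\<close>

text \<open>
  The two halves of the universal property of a presentation. The second one identifies a composite
  of homomorphisms with the identity from its values on the base and on the generators.
\<close>

lemma presented_hom_lift:
  assumes A: "complex_algebra A" and R: "R \<subseteq> carrier (adjoin A V) \<times> carrier (adjoin A V)"
    and B: "complex_algebra B" and h: "h \<in> alg_hom (adjoin A V) B"
    and hR: "\<And>l r. (l, r) \<in> R \<Longrightarrow> h l = h r"
  shows "\<exists>h' \<in> alg_hom (quot_alg (adjoin A V) R) B.
    (\<forall>a\<in>carrier A. h' (quot_proj (adjoin A V) R (adj_base A V a)) = h (adj_base A V a)) \<and>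
    (\<forall>x\<in>V. h' (quot_proj (adjoin A V) R (adj_gen A V x)) = h (adj_gen A V x))"
  using quot_hom_lift[OF complex_algebra_adjoin[OF A] R B h hR]
  by (meson A adj_base_closed adj_gen_closed)

lemma presented_hom_eq:
  assumes A: "complex_algebra A" and R: "R \<subseteq> carrier (adjoin A V) \<times> carrier (adjoin A V)"
    and h: "h \<in> alg_hom (quot_alg (adjoin A V) R) B" "h' \<in> alg_hom (quot_alg (adjoin A V) R) B"
    and eqA: "\<And>a. a \<in> carrier A \<Longrightarrow> h (quot_proj (adjoin A V) R (adj_base A V a))
      = h' (quot_proj (adjoin A V) R (adj_base A V a))"
    and eqV: "\<And>x. x \<in> V \<Longrightarrow> h (quot_proj (adjoin A V) R (adj_gen A V x))
      = h' (quot_proj (adjoin A V) R (adj_gen A V x))"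
    and X: "X \<in> carrier (quot_alg (adjoin A V) R)"
  shows "h X = h' X"
proof (rule quot_hom_eq[OF complex_algebra_adjoin[OF A] R _ X])
  fix a assume a: "a \<in> carrier (adjoin A V)"
  note q = quot_proj_hom[OF complex_algebra_adjoin[OF A] R]
  show "h (quot_proj (adjoin A V) R a) = h' (quot_proj (adjoin A V) R a)"
    by (rule adjoin_hom_eq[OF A alg_hom_comp[OF q h(1)] alg_hom_comp[OF q h(2)] _ _ a])
      (simp_all add: eqA eqV)
qed

text \<open>
  Translating the generators by elements of the base is a change of variables: the two
  substitutions \<open>x \<mapsto> x + u x\<close> and \<open>x \<mapsto> x - u x\<close> are inverse to each other, so they induce inverse
  isomorphisms as soon as each of them turns one set of relations into valid identities.
\<close>

lemma presented_by_translate: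
  fixes A :: "'a calg" and V :: "'x set"
  defines "F \<equiv> adjoin A V"
  assumes A: "complex_algebra A"
    and R: "R \<subseteq> carrier F \<times> carrier F" and R': "R' \<subseteq> carrier F \<times> carrier F"
    and u: "\<And>x. x \<in> V \<Longrightarrow> u x \<in> carrier A"
    and toR: "\<And>h l r. \<lbrakk>h \<in> alg_hom F (quot_alg F R);
        \<And>a. a \<in> carrier A \<Longrightarrow> h (adj_base A V a) = quot_proj F R (adj_base A V a);
        \<And>x. x \<in> V \<Longrightarrow> h (adj_gen A V x) = quot_proj F R (adj_gen A V x \<oplus>\<^bsub>F\<^esub> adj_base A V (u x));
        (l, r) \<in> R'\<rbrakk> \<Longrightarrow> h l = h r"
    and toR': "\<And>h l r. \<lbrakk>h \<in> alg_hom F (quot_alg F R');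
        \<And>a. a \<in> carrier A \<Longrightarrow> h (adj_base A V a) = quot_proj F R' (adj_base A V a);
        \<And>x. x \<in> V \<Longrightarrow> h (adj_gen A V x) = quot_proj F R' (adj_gen A V x \<ominus>\<^bsub>F\<^esub> adj_base A V (u x));
        (l, r) \<in> R\<rbrakk> \<Longrightarrow> h l = h r"
  shows "presented_by (quot_alg F R) A (\<lambda>a. quot_proj F R (adj_base A V a)) V
    (\<lambda>x. quot_proj F R (adj_gen A V x \<oplus>\<^bsub>F\<^esub> adj_base A V (u x))) R'"
proof -
  have F: "complex_algebra F" unfolding F_def by (rule complex_algebra_adjoin[OF A])
  interpret F: complex_algebra F by (rule F)
  have Q: "complex_algebra (quot_alg F R)" "complex_algebra (quot_alg F R')"
    by (rule complex_algebra_quot[OF F R], rule complex_algebra_quot[OF F R'])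
  interpret Q: complex_algebra "quot_alg F R" by (rule Q)
  interpret Q': complex_algebra "quot_alg F R'" by (rule Q)
  let ?q = "quot_proj F R" and ?q' = "quot_proj F R'"
  let ?a = "adj_base A V" and ?g = "adj_gen A V"
  have q: "?q \<in> alg_hom F (quot_alg F R)" "?q' \<in> alg_hom F (quot_alg F R')"
    by (rule quot_proj_hom[OF F R], rule quot_proj_hom[OF F R'])
  have a: "?a \<in> alg_hom A F" unfolding F_def by (rule adj_base_hom[OF A])
  have ac: "?a x \<in> carrier F" if "x \<in> carrier A" for x using alg_hom_closed[OF a that] .
  have g: "?g x \<in> carrier F" if "x \<in> V" for x
    unfolding F_def using adj_gen_closed[OF A that] .
  note qc = alg_hom_closed[OF q(1)] alg_hom_closed[OF q(2)]
  obtain t where t: "t \<in> alg_hom F (quot_alg F R)"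
    "\<And>x. x \<in> carrier A \<Longrightarrow> t (?a x) = ?q (?a x)"
    "\<And>x. x \<in> V \<Longrightarrow> t (?g x) = ?q (?g x \<oplus>\<^bsub>F\<^esub> ?a (u x))"
    using adjoin_hom_lift[OF A Q(1) alg_hom_comp[OF a q(1)], of V "\<lambda>x. ?q (?g x \<oplus>\<^bsub>F\<^esub> ?a (u x))",
        folded F_def, OF qc(1)] ac g u by auto
  obtain t' where t': "t' \<in> alg_hom F (quot_alg F R')"
    "\<And>x. x \<in> carrier A \<Longrightarrow> t' (?a x) = ?q' (?a x)"
    "\<And>x. x \<in> V \<Longrightarrow> t' (?g x) = ?q' (?g x \<ominus>\<^bsub>F\<^esub> ?a (u x))"
    using adjoin_hom_lift[OF A Q(2) alg_hom_comp[OF a q(2)], of V "\<lambda>x. ?q' (?g x \<ominus>\<^bsub>F\<^esub> ?a (u x))",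
        folded F_def, OF qc(2)] ac g u by auto
  have tR: "t l = t r" if "(l, r) \<in> R'" for l r
    by (rule toR[OF t(1) _ _ that]) (simp_all add: t)
  have tR': "t' l = t' r" if "(l, r) \<in> R" for l r
    by (rule toR'[OF t'(1) _ _ that]) (simp_all add: t')
  obtain h where h: "h \<in> alg_hom (quot_alg F R') (quot_alg F R)"
    "\<And>x. x \<in> carrier A \<Longrightarrow> h (?q' (?a x)) = t (?a x)" "\<And>x. x \<in> V \<Longrightarrow> h (?q' (?g x)) = t (?g x)"
    using presented_hom_lift[OF A, of R' V, folded F_def, OF R' Q(1) t(1) tR] by blast
  obtain h' where h': "h' \<in> alg_hom (quot_alg F R) (quot_alg F R')"
    "\<And>x. x \<in> carrier A \<Longrightarrow> h' (?q (?a x)) = t' (?a x)" "\<And>x. x \<in> V \<Longrightarrow> h' (?q (?g x)) = t' (?g x)"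
    using presented_hom_lift[OF A, of R V, folded F_def, OF R Q(2) t'(1) tR'] by blast
  have V: "h' (h (?q' (?g x))) = ?q' (?g x)" "h (h' (?q (?g x))) = ?q (?g x)" if "x \<in> V" for x
  proof -
    note [simp] = that u[OF that] ac[OF u[OF that]] g[OF that] qc
    have "h' (h (?q' (?g x))) = (?q' (?g x) \<ominus>\<^bsub>quot_alg F R'\<^esub> ?q' (?a (u x))) \<oplus>\<^bsub>quot_alg F R'\<^esub> ?q' (?a (u x))"
      by (simp add: h t alg_hom_add[OF q(1)] alg_hom_add[OF h'(1)] h' t'
          alg_hom_minus[OF F.ring_axioms Q'.ring_axioms q(2)])
    then show "h' (h (?q' (?g x))) = ?q' (?g x)"
      by (simp add: a_minus_def Q'.a_assoc Q'.l_neg)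
    have "h (h' (?q (?g x))) = (?q (?g x) \<oplus>\<^bsub>quot_alg F R\<^esub> ?q (?a (u x))) \<ominus>\<^bsub>quot_alg F R\<^esub> ?q (?a (u x))"
      by (simp add: h t h' t' alg_hom_add[OF q(1)] alg_hom_minus[OF F.ring_axioms Q'.ring_axioms q(2)]
         alg_hom_minus[OF Q'.ring_axioms Q.ring_axioms h(1)])
    then show "h (h' (?q (?g x))) = ?q (?g x)"
      by (simp add: a_minus_def Q.a_assoc Q.r_neg)
  qed
  have "h \<in> alg_iso (quot_alg F R') (quot_alg F R)"
  proof (rule alg_isoI[OF h(1) h'(1)])
    show "h' (h X) = X" if "X \<in> carrier (quot_alg F R')" for X
      by (rule presented_hom_eq[OF A R'[unfolded F_def], folded F_def,
            OF alg_hom_comp[OF h(1) h'(1)] alg_hom_id _ _ that]) (simp add: h t h' t', rule V)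
    show "h (h' X) = X" if "X \<in> carrier (quot_alg F R)" for X
      by (rule presented_hom_eq[OF A R[unfolded F_def], folded F_def,
            OF alg_hom_comp[OF h'(1) h(1)] alg_hom_id _ _ that]) (simp add: h t h' t', rule V)
  qed
  then show ?thesis
    unfolding presented_by_def F_def[symmetric] using h t by (intro bexI[of _ h]) auto
qed


section \<open>Reflections in the group algebra\<close>

lemma G_carrier_iff:
  assumes "m \<ge> 1"
  shows "(w, t) \<in> carrier (G_grp m n) \<longleftrightarrow> w permutes {1..n} \<and> t \<in> {1..n} \<rightarrow>\<^sub>E {0..<int m}"
  using assms by (simp add: G_grp_def sym_group_def torus_def carrier_integer_mod_group)

lemma G_mult:
  "(w, t) \<otimes>\<^bsub>G_grp m n\<^esub> (w', t') = (w \<circ> w', \<lambda>j\<in>{1..n}. (t (w' j) + t' j) mod int m)"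
  by (auto simp: G_grp_def sym_group_def torus_def fun_eq_iff)

lemma G_one: "\<one>\<^bsub>G_grp m n\<^esub> = (id, \<lambda>j\<in>{1..n}. 0)"
  by (auto simp: G_grp_def sym_group_def torus_def fun_eq_iff)

lemma g_elt_int_pow:
  assumes "m \<ge> 1"
  shows "g_elt m n i [^]\<^bsub>G_grp m n\<^esub> (l::int) = (id, \<lambda>q\<in>{1..n}. if q = i then l mod int m else 0)"
proof -
  interpret G: group "G_grp m n" by (rule group_G)
  note g = g_elt_closed[OF assms, of n i]
  have nat: "g_elt m n i [^]\<^bsub>G_grp m n\<^esub> (a::nat) = (id, \<lambda>q\<in>{1..n}. if q = i then int a mod int m else 0)" for a
  proof (induct a)
    case (Suc a)
    have "(int a mod int m + 1 mod int m) mod int m = int (Suc a) mod int m"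
      by (simp add: mod_add_eq add.commute)
    then show ?case
      unfolding G.nat_pow_Suc Suc unfolding g_elt_def G_mult by (auto simp: fun_eq_iff simp del: of_nat_Suc)
  qed (simp add: G_one fun_eq_iff)
  show ?thesis
  proof (cases l rule: int_cases2)
    case (nonneg a)
    show ?thesis unfolding nonneg int_pow_int by (rule nat)
  next
    case (nonpos a)
    have "g_elt m n i [^]\<^bsub>G_grp m n\<^esub> l = inv\<^bsub>G_grp m n\<^esub> (g_elt m n i [^]\<^bsub>G_grp m n\<^esub> a)"
      unfolding nonpos by (rule G.int_pow_neg_int[OF g])
    also have "\<dots> = (id, \<lambda>q\<in>{1..n}. if q = i then l mod int m else 0)"
    proof (rule G.inv_equality)
      show "(id, \<lambda>q\<in>{1..n}. if q = i then l mod int m else 0) \<in> carrier (G_grp m n)"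
        using assms by (auto simp: G_carrier_iff permutes_id)
      show "(id, \<lambda>q\<in>{1..n}. if q = i then l mod int m else 0)
          \<otimes>\<^bsub>G_grp m n\<^esub> (g_elt m n i [^]\<^bsub>G_grp m n\<^esub> a) = \<one>\<^bsub>G_grp m n\<^esub>"
        unfolding nat nonpos by (auto simp: G_mult G_one fun_eq_iff mod_simps)
    qed (rule G.nat_pow_closed[OF g])
    finally show ?thesis .
  qed
qed

text \<open>
  The reflections of \<open>G(m,1,n)\<close> above the transposition of \<open>i\<close> and \<open>j\<close>. Describing this set by
  equations makes its symmetry in \<open>i\<close>, \<open>j\<close> and its behaviour under conjugation visible.
\<close>

definition refls :: "nat \<Rightarrow> nat \<Rightarrow> nat \<Rightarrow> nat \<Rightarrow> gelt set" where
  "refls m n i j = {(transpose i j, t) |t. t \<in> {1..n} \<rightarrow>\<^sub>E {0..<int m} \<and>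
     (t i + t j) mod int m = 0 \<and> (\<forall>q\<in>{1..n} - {i, j}. t q = 0)}"

lemma refls_iff:
  "(v, t) \<in> refls m n i j \<longleftrightarrow> v = transpose i j \<and> t \<in> {1..n} \<rightarrow>\<^sub>E {0..<int m} \<and>
     (t i + t j) mod int m = 0 \<and> (\<forall>q\<in>{1..n} - {i, j}. t q = 0)"
  by (simp add: refls_def)

lemma refls_commute: "refls m n i j = refls m n j i"
  by (simp add: refls_def transpose_commute add.commute insert_commute)

lemma refls_closed:
  "\<lbrakk>m \<ge> 1; i \<in> {1..n}; j \<in> {1..n}\<rbrakk> \<Longrightarrow> refls m n i j \<subseteq> carrier (G_grp m n)"
  by (auto simp: refls_def G_carrier_iff permutes_swap_id)

text \<open>
  The \<open>m\<close> summands of \<open>s\<^sub>i\<^sub>j \<epsilon>\<^sub>i\<^sub>j\<close> run through the reflections exactly once: the exponent \<open>l\<close> is recovered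
  as the \<open>i\<close>-th coordinate of the torus part.
\<close>

lemma refls_param:
  assumes m: "m \<ge> 1" and ij: "i \<in> {1..n}" "j \<in> {1..n}" "i \<noteq> j"
  shows "bij_betw (\<lambda>l. perm_elt m n (transpose i j) \<otimes>\<^bsub>G_grp m n\<^esub>
      (g_elt m n i [^]\<^bsub>G_grp m n\<^esub> int l \<otimes>\<^bsub>G_grp m n\<^esub> g_elt m n j [^]\<^bsub>G_grp m n\<^esub> (- int l))) {..<m} (refls m n i j)"
proof -
  have eq: "perm_elt m n (transpose i j) \<otimes>\<^bsub>G_grp m n\<^esub>
      (g_elt m n i [^]\<^bsub>G_grp m n\<^esub> int l \<otimes>\<^bsub>G_grp m n\<^esub> g_elt m n j [^]\<^bsub>G_grp m n\<^esub> (- int l))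
    = (transpose i j, \<lambda>q\<in>{1..n}. if q = i then int l else if q = j then (- int l) mod int m else 0)"
    if "l < m" for l
    unfolding g_elt_int_pow[OF m] perm_elt_def
    using that ij by (auto simp: G_mult torus_def fun_eq_iff)
  have "bij_betw (\<lambda>l. (transpose i j, \<lambda>q\<in>{1..n}. if q = i then int l else if q = j then (- int l) mod int m else 0))
      {..<m} (refls m n i j)"
  proof (rule bij_betw_byWitness[where f' = "\<lambda>x. nat (snd x i)"])
    show "\<forall>x\<in>refls m n i j. (transpose i j, \<lambda>q\<in>{1..n}. if q = i then int (nat (snd x i))
        else if q = j then (- int (nat (snd x i))) mod int m else 0) = x"
    proof
      fix x assume "x \<in> refls m n i j"
      then obtain t where x: "x = (transpose i j, t)" and t: "t \<in> {1..n} \<rightarrow>\<^sub>E {0..<int m}"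
        and s: "(t i + t j) mod int m = 0" and z: "\<forall>q\<in>{1..n} - {i, j}. t q = 0"
        by (auto simp: refls_def)
      have r: "t q \<in> {0..<int m}" if "q \<in> {1..n}" for q using t that by auto
      have "(- t i) mod int m = t j"
      proof -
        have "(- t i) mod int m = (t j - (t i + t j)) mod int m" by simp
        also have "\<dots> = t j mod int m" using s by (metis diff_zero mod_diff_right_eq)
        finally show ?thesis using r[OF ij(2)] by simp
      qed
      moreover have "t q = undefined" if "q \<notin> {1..n}" for q using t that by auto
      ultimately show "(transpose i j, \<lambda>q\<in>{1..n}. if q = i then int (nat (snd x i))
        else if q = j then (- int (nat (snd x i))) mod int m else 0) = x"
        using r[OF ij(1)] z by (auto simp: x fun_eq_iff)
    qed
  qed (use ij m in \<open>auto simp: refls_def nat_less_iff mod_simps dest: PiE_mem\<close>)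
  then show ?thesis by (rule bij_betw_cong[THEN iffD1, rotated]) (simp add: eq)
qed

text \<open>
  Conjugation by \<open>g = (w, t)\<close> turns reflections above \<open>(i j)\<close> into reflections above \<open>(w i  w j)\<close>;
  in the condition on the sum of the two coordinates, \<open>g\<close> contributes \<open>t i + t j\<close> to both sides.
\<close>

lemma refls_conj_iff:
  assumes m: "m \<ge> 1" and ij: "i \<in> {1..n}" "j \<in> {1..n}"
    and g: "(w, t) \<in> carrier (G_grp m n)" and x: "x \<in> carrier (G_grp m n)" and x': "x' \<in> carrier (G_grp m n)"
    and eq: "(w, t) \<otimes>\<^bsub>G_grp m n\<^esub> x = x' \<otimes>\<^bsub>G_grp m n\<^esub> (w, t)"
  shows "x \<in> refls m n i j \<longleftrightarrow> x' \<in> refls m n (w i) (w j)"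
proof -
  obtain v u v' u' where xs: "x = (v, u)" "x' = (v', u')" by (metis surj_pair)
  have w: "w permutes {1..n}" and u: "u \<in> {1..n} \<rightarrow>\<^sub>E {0..<int m}" and u': "u' \<in> {1..n} \<rightarrow>\<^sub>E {0..<int m}"
    using g x x' m by (auto simp: xs G_carrier_iff)
  have vw: "w \<circ> v = v' \<circ> w" using eq by (simp add: xs G_mult)
  have tw: "(t (v q) + u q) mod int m = (u' (w q) + t q) mod int m" if "q \<in> {1..n}" for q
    using eq that by (auto simp: xs G_mult fun_eq_iff split: if_splits)
  have wt: "w \<circ> transpose i j = transpose (w i) (w j) \<circ> w"
    using permutes_inj[OF w] by (auto simp: fun_eq_iff transpose_def inj_eq)
  have v: "v = transpose i j \<longleftrightarrow> v' = transpose (w i) (w j)"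
  proof
    assume "v = transpose i j"
    with vw wt have "v' \<circ> w = transpose (w i) (w j) \<circ> w" by simp
    then show "v' = transpose (w i) (w j)"
      using permutes_surj[OF w] by (metis fun.map_comp surj_iff comp_assoc comp_id)
  next
    assume "v' = transpose (w i) (w j)"
    with vw wt have "w \<circ> v = w \<circ> transpose i j" by simp
    then show "v = transpose i j"
      using permutes_inj[OF w] by (simp add: fun.inj_map_strong fun_eq_iff inj_eq)
  qed
  have wr: "w q \<in> {1..n} \<longleftrightarrow> q \<in> {1..n}" for q using permutes_in_image[OF w] .
  have rest: "u q = u' (w q)" if "v = transpose i j" "q \<in> {1..n} - {i, j}" for q
  proof -
    have "(t q + u q) mod int m = (t q + u' (w q)) mod int m"
      using tw[of q] that by (simp add: add.commute)
    then have "u q mod int m = u' (w q) mod int m"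
      by (metis add_diff_cancel_left' mod_diff_left_eq)
    moreover have "u q \<in> {0..<int m}" "u' (w q) \<in> {0..<int m}" using u u' that wr[of q] by auto
    ultimately show ?thesis by simp
  qed
  have sums: "(u i + u j) mod int m = (u' (w i) + u' (w j)) mod int m" if "v = transpose i j"
  proof -
    have "(t j + u i) mod int m = (u' (w i) + t i) mod int m" "(t i + u j) mod int m = (u' (w j) + t j) mod int m"
      using tw[OF ij(1)] tw[OF ij(2)] that by simp_all
    then have "int m dvd (t j + u i) - (u' (w i) + t i)" "int m dvd (t i + u j) - (u' (w j) + t j)"
      by (simp_all add: mod_eq_dvd_iff)
    then have "int m dvd ((t j + u i) - (u' (w i) + t i)) + ((t i + u j) - (u' (w j) + t j))"
      by (rule dvd_add)
    then have "int m dvd (u i + u j) - (u' (w i) + u' (w j))" by (simp add: algebra_simps)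
    then show ?thesis by (simp add: mod_eq_dvd_iff)
  qed
  have all: "(\<forall>q\<in>{1..n} - {w i, w j}. u' q = 0) \<longleftrightarrow> (\<forall>q\<in>{1..n} - {i, j}. u' (w q) = 0)"
  proof -
    have "{1..n} - {w i, w j} = w ` ({1..n} - {i, j})"
      using permutes_image[OF w] permutes_inj[OF w] by (auto simp: image_set_diff)
    then show ?thesis by simp
  qed
  have mem: "(v, u) \<in> refls m n i j \<longleftrightarrow>
      v = transpose i j \<and> (u i + u j) mod int m = 0 \<and> (\<forall>q\<in>{1..n} - {i, j}. u q = 0)"
    "(v', u') \<in> refls m n (w i) (w j) \<longleftrightarrow>
      v' = transpose (w i) (w j) \<and> (u' (w i) + u' (w j)) mod int m = 0 \<and> (\<forall>q\<in>{1..n} - {w i, w j}. u' q = 0)"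
    by (simp_all only: refls_iff u u' simp_thms)
  show ?thesis
  proof (cases "v = transpose i j")
    case True
    then show ?thesis unfolding xs mem all v[symmetric] sums[OF True] using rest[OF True] by simp
  qed (simp add: xs mem v[symmetric])
qed

definition refl_sum :: "nat \<Rightarrow> nat \<Rightarrow> complex \<Rightarrow> nat \<Rightarrow> nat \<Rightarrow> gelt \<Rightarrow>\<^sub>0 complex" where
  "refl_sum m n c i j = (\<Sum>x\<in>refls m n i j. Poly_Mapping.single x c)"

lemma refl_sum_commute: "refl_sum m n c i j = refl_sum m n c j i"
  by (simp add: refl_sum_def refls_commute)

lemma refl_sum_zero: "refl_sum m n 0 i j = 0"
  by (simp add: refl_sum_def)

lemma refl_sum_add: "refl_sum m n (c + d) i j = refl_sum m n c i j + refl_sum m n d i j"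
  by (simp add: refl_sum_def single_add sum.distrib)

lemma CG_sum_closed:
  "(\<And>x. x \<in> X \<Longrightarrow> f x \<in> carrier (CG m n)) \<Longrightarrow> sum f X \<in> carrier (CG m n)"
proof (induct X rule: infinite_finite_induct)
  case (insert x X)
  interpret C: complex_algebra "CG m n" by (rule complex_algebra_CG)
  show ?case using insert C.a_closed[of "f x" "sum f X"] by (simp add: CG_def ma_simps)
qed (simp_all add: CG_def ma_simps)

lemma refl_sum_closed:
  "\<lbrakk>m \<ge> 1; i \<in> {1..n}; j \<in> {1..n}\<rbrakk> \<Longrightarrow> refl_sum m n c i j \<in> carrier (CG m n)"
  unfolding refl_sum_def using refls_closed[of m i n j]
  by (intro CG_sum_closed) (auto simp: CG_def ma_simps)

lemma refl_sum_covariant: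
  assumes m: "m \<ge> 1" and ij: "i \<in> {1..n}" "j \<in> {1..n}" and g: "(w, t) \<in> carrier (G_grp m n)"
  shows "basis_elt (w, t) \<otimes>\<^bsub>CG m n\<^esub> refl_sum m n c i j = refl_sum m n c (w i) (w j) \<otimes>\<^bsub>CG m n\<^esub> basis_elt (w, t)"
proof -
  interpret G: group "G_grp m n" by (rule group_G)
  let ?g = "(w, t)"
  have wij: "w i \<in> {1..n}" "w j \<in> {1..n}"
    using g ij m permutes_in_image[of w "{1..n}"] by (auto simp: G_carrier_iff)
  note cl = refls_closed[OF m ij] refls_closed[OF m wij]
  have "(\<Sum>x\<in>refls m n i j. Poly_Mapping.single (?g \<otimes>\<^bsub>G_grp m n\<^esub> x) c)
      = (\<Sum>x\<in>refls m n (w i) (w j). Poly_Mapping.single (x \<otimes>\<^bsub>G_grp m n\<^esub> ?g) c)"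
  proof (rule sum.reindex_bij_witness[where j = "\<lambda>x. ?g \<otimes>\<^bsub>G_grp m n\<^esub> x \<otimes>\<^bsub>G_grp m n\<^esub> inv\<^bsub>G_grp m n\<^esub> ?g"
        and i = "\<lambda>x. inv\<^bsub>G_grp m n\<^esub> ?g \<otimes>\<^bsub>G_grp m n\<^esub> x \<otimes>\<^bsub>G_grp m n\<^esub> ?g"])
    fix x assume x: "x \<in> refls m n i j"
    have xc: "x \<in> carrier (G_grp m n)" using x cl by auto
    let ?x = "?g \<otimes>\<^bsub>G_grp m n\<^esub> x \<otimes>\<^bsub>G_grp m n\<^esub> inv\<^bsub>G_grp m n\<^esub> ?g"
    have e: "?g \<otimes>\<^bsub>G_grp m n\<^esub> x = ?x \<otimes>\<^bsub>G_grp m n\<^esub> ?g" using g xc by (simp add: G.m_assoc)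
    show "?x \<in> refls m n (w i) (w j)"
      using refls_conj_iff[OF m ij g xc _ e] x g xc by auto
    show "inv\<^bsub>G_grp m n\<^esub> ?g \<otimes>\<^bsub>G_grp m n\<^esub> ?x \<otimes>\<^bsub>G_grp m n\<^esub> ?g = x"
      using g xc by (simp add: G.m_assoc G.inv_solve_left')
    show "Poly_Mapping.single (?x \<otimes>\<^bsub>G_grp m n\<^esub> ?g) c = Poly_Mapping.single (?g \<otimes>\<^bsub>G_grp m n\<^esub> x) c"
      using e by simp
  next
    fix x assume x: "x \<in> refls m n (w i) (w j)"
    have xc: "x \<in> carrier (G_grp m n)" using x cl by auto
    let ?x = "inv\<^bsub>G_grp m n\<^esub> ?g \<otimes>\<^bsub>G_grp m n\<^esub> x \<otimes>\<^bsub>G_grp m n\<^esub> ?g"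
    have e: "?g \<otimes>\<^bsub>G_grp m n\<^esub> ?x = x \<otimes>\<^bsub>G_grp m n\<^esub> ?g" using g xc by (simp add: G.m_assoc[symmetric])
    show "?x \<in> refls m n i j"
      using refls_conj_iff[OF m ij g _ xc e] x g xc by auto
    show "?g \<otimes>\<^bsub>G_grp m n\<^esub> ?x \<otimes>\<^bsub>G_grp m n\<^esub> inv\<^bsub>G_grp m n\<^esub> ?g = x"
      unfolding e using g xc by (simp add: G.m_assoc)
  qed
  then show ?thesis
    by (simp add: refl_sum_def basis_elt_def CG_def ma_mult_sum_left ma_mult_sum_right ma_mult_single)
qed

text \<open>
  By symmetry in \<open>i\<close> and \<open>i + 1\<close> the sum of the reflections commutes with \<open>s\<^sub>i\<close>, and it equals
  \<open>s\<^sub>i \<epsilon>\<^sub>i\<^sub>,\<^sub>i\<^sub>+\<^sub>1\<close>; multiplying by \<open>s\<^sub>i\<close> once more removes the transposition.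
\<close>

lemma refl_sum_eps:
  assumes m: "m \<ge> 1" and i: "i \<in> {1..<n}"
  shows "refl_sum m n k i (i + 1) \<otimes>\<^bsub>CG m n\<^esub> basis_elt (s_elt m n i) = k \<odot>\<^bsub>CG m n\<^esub> eps m n i (i + 1)"
proof -
  interpret G: group "G_grp m n" by (rule group_G)
  let ?x = "\<lambda>l. g_elt m n i [^]\<^bsub>G_grp m n\<^esub> int l \<otimes>\<^bsub>G_grp m n\<^esub> g_elt m n (i + 1) [^]\<^bsub>G_grp m n\<^esub> (- int l)"
  have ij: "i \<in> {1..n}" "i + 1 \<in> {1..n}" "i \<noteq> i + 1" using i by auto
  have xc: "?x l \<in> carrier (G_grp m n)" for l
    using g_elt_closed[OF m] by (intro G.m_closed G.int_pow_closed)
  note s = s_elt_closed[OF i, of m]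
  have ss: "s_elt m n i \<otimes>\<^bsub>G_grp m n\<^esub> s_elt m n i = \<one>\<^bsub>G_grp m n\<^esub>"
    using i by (auto simp: s_elt_def perm_elt_def torus_def G_mult G_one fun_eq_iff transpose_def)
  have "refl_sum m n k i (i + 1) \<otimes>\<^bsub>CG m n\<^esub> basis_elt (s_elt m n i)
      = basis_elt (s_elt m n i) \<otimes>\<^bsub>CG m n\<^esub> refl_sum m n k i (i + 1)"
    using refl_sum_covariant[OF m ij(1,2) s[unfolded s_elt_def perm_elt_def], of k]
    by (simp add: s_elt_def perm_elt_def refl_sum_commute)
  also have "\<dots> = basis_elt (s_elt m n i) \<otimes>\<^bsub>CG m n\<^esub>
      (\<Sum>l<m. Poly_Mapping.single (s_elt m n i \<otimes>\<^bsub>G_grp m n\<^esub> ?x l) k)"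
    unfolding refl_sum_def s_elt_def by (simp only: sum.reindex_bij_betw[OF refls_param[OF m ij], symmetric])
  also have "\<dots> = (\<Sum>l<m. Poly_Mapping.single (?x l) k)"
    unfolding CG_def basis_elt_def ma_mult_sum_right ma_mult_single
    using s xc by (simp add: G.m_assoc[symmetric] ss)
  also have "\<dots> = Poly_Mapping.map ((*) k) (\<Sum>l<m. basis_elt (?x l))"
    by (rule poly_mapping_eqI)
      (simp add: lookup_map_scale lookup_sum basis_elt_def lookup_single when_def sum_distrib_left if_distrib cong: if_cong)
  also have "\<dots> = k \<odot>\<^bsub>CG m n\<^esub> eps m n i (i + 1)"
    by (simp only: eps_def CG_def ma_simps)
  finally show ?thesis .
qed

section \<open>The correction terms\<close>

definition weighted :: "nat \<Rightarrow> nat \<Rightarrow> (nat \<Rightarrow> complex) \<Rightarrow> nat \<Rightarrow> gelt \<Rightarrow>\<^sub>0 complex" where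
  "weighted m n \<sigma> i = (\<Sum>j\<in>{1..n}. refl_sum m n (\<sigma> j) i j)"

text \<open>
  The weight of \<open>j = i\<close> is \<open>0\<close>, so only honest reflections contribute. The factor \<open>1/2\<close> is forced by
  two requirements: changing one sign has to shift the sum by \<open>k\<close>, and the weights of
  \<open>{i, j}\<close> in the \<open>i\<close>-th and the \<open>j\<close>-th sum have to be opposite.
\<close>

definition corr :: "nat \<Rightarrow> nat \<Rightarrow> complex \<Rightarrow> nat \<Rightarrow> gelt \<Rightarrow>\<^sub>0 complex" where
  "corr m n k i = weighted m n (\<lambda>j. k / 2 * of_int (sgn (int j - int i))) i"

lemma weighted_closed:
  "\<lbrakk>m \<ge> 1; i \<in> {1..n}\<rbrakk> \<Longrightarrow> weighted m n \<sigma> i \<in> carrier (CG m n)"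
  unfolding weighted_def by (intro CG_sum_closed refl_sum_closed)

lemma corr_closed: "\<lbrakk>m \<ge> 1; i \<in> {1..n}\<rbrakk> \<Longrightarrow> corr m n k i \<in> carrier (CG m n)"
  unfolding corr_def by (rule weighted_closed)

text \<open>
  Transporting the weights along the permutation keeps track of what conjugation does to a sum whose
  coefficients depend on the order of the indices.
\<close>

lemma weighted_covariant:
  assumes m: "m \<ge> 1" and i: "i \<in> {1..n}" and g: "(w, t) \<in> carrier (G_grp m n)"
  shows "basis_elt (w, t) \<otimes>\<^bsub>CG m n\<^esub> weighted m n (\<lambda>j. \<sigma> (w j)) i
    = weighted m n \<sigma> (w i) \<otimes>\<^bsub>CG m n\<^esub> basis_elt (w, t)"
proof -
  have w: "w permutes {1..n}" using g m by (simp add: G_carrier_iff)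
  have "basis_elt (w, t) \<otimes>\<^bsub>CG m n\<^esub> weighted m n (\<lambda>j. \<sigma> (w j)) i
      = (\<Sum>j\<in>{1..n}. refl_sum m n (\<sigma> (w j)) (w i) (w j) \<otimes>\<^bsub>CG m n\<^esub> basis_elt (w, t))"
    unfolding weighted_def CG_def ma_mult_sum_right
    by (rule sum.cong[OF refl]) (rule refl_sum_covariant[OF m i _ g, unfolded CG_def])
  also have "\<dots> = (\<Sum>j\<in>{1..n}. refl_sum m n (\<sigma> j) (w i) j \<otimes>\<^bsub>CG m n\<^esub> basis_elt (w, t))"
    by (rule sum.permute[OF w, symmetric, unfolded comp_def])
  finally show ?thesis by (simp add: weighted_def CG_def ma_mult_sum_left)
qed

lemma corr_g:
  assumes m: "m \<ge> 1" and i: "i \<in> {1..n}"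
  shows "basis_elt (g_elt m n r) \<otimes>\<^bsub>CG m n\<^esub> corr m n k i = corr m n k i \<otimes>\<^bsub>CG m n\<^esub> basis_elt (g_elt m n r)"
  using weighted_covariant[OF m i g_elt_closed[OF m, of n r, unfolded g_elt_def],
      of "\<lambda>j. k / 2 * of_int (sgn (int j - int i))"]
  by (simp add: corr_def g_elt_def)

lemma corr_s_other:
  assumes m: "m \<ge> 1" and j: "j \<in> {1..n}" "j \<noteq> i" "j \<noteq> i + 1" and i: "i \<in> {1..<n}"
  shows "basis_elt (s_elt m n i) \<otimes>\<^bsub>CG m n\<^esub> corr m n k j = corr m n k j \<otimes>\<^bsub>CG m n\<^esub> basis_elt (s_elt m n i)"
proof -
  have "sgn (int (transpose i (i + 1) l) - int j) = sgn (int l - int j)" for l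
    using j by (auto simp: transpose_def sgn_if)
  then show ?thesis
    using weighted_covariant[OF m j(1) s_elt_closed[OF i, of m, unfolded s_elt_def perm_elt_def],
      of "\<lambda>l. k / 2 * of_int (sgn (int l - int j))"] j
    by (simp add: corr_def s_elt_def perm_elt_def)
qed

text \<open>
  Exchanging \<open>i\<close> and \<open>i + 1\<close> preserves the order of all pairs except \<open>{i, i + 1}\<close> itself, so the
  sign pattern changes in a single term, by twice its coefficient \<open>k/2\<close>.
\<close>

lemma corr_s:
  assumes m: "m \<ge> 1" and i: "i \<in> {1..<n}"
  shows "corr m n k i \<otimes>\<^bsub>CG m n\<^esub> basis_elt (s_elt m n i)
    = (basis_elt (s_elt m n i) \<otimes>\<^bsub>CG m n\<^esub> corr m n k (i + 1)) \<oplus>\<^bsub>CG m n\<^esub> (k \<odot>\<^bsub>CG m n\<^esub> eps m n i (i + 1))"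
proof -
  have ij: "i \<in> {1..n}" "i + 1 \<in> {1..n}" using i by auto
  \<comment> \<open>\<open>\<sigma>\<close> is the weight function of the \<open>(i + 1)\<close>-st correction term, transported along \<open>s\<^sub>i\<close>.\<close>
  define \<sigma> where "\<sigma> l = k / 2 * of_int (sgn (int (transpose i (i + 1) l) - int (i + 1)))" for l
  have \<sigma>: "k / 2 * of_int (sgn (int l - int i)) = \<sigma> l + (if l = i + 1 then k else 0)" for l
    by (auto simp: \<sigma>_def transpose_def sgn_if)
  have "refl_sum m n (if l = i + 1 then k else 0) i l = (if l = i + 1 then refl_sum m n k i l else 0)" for l
    by (simp add: refl_sum_zero)
  note split = this
  have "corr m n k i = (\<Sum>l\<in>{1..n}. refl_sum m n (\<sigma> l) i l + refl_sum m n (if l = i + 1 then k else 0) i l)"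
    unfolding corr_def weighted_def \<sigma> by (simp only: refl_sum_add)
  also have "\<dots> = weighted m n \<sigma> i + (\<Sum>l\<in>{1..n}. if l = i + 1 then refl_sum m n k i l else 0)"
    unfolding sum.distrib weighted_def split ..
  also have "\<dots> = weighted m n \<sigma> i + refl_sum m n k i (i + 1)"
    using ij by simp
  finally have c: "corr m n k i = weighted m n \<sigma> i + refl_sum m n k i (i + 1)" .
  have "basis_elt (s_elt m n i) \<otimes>\<^bsub>CG m n\<^esub> corr m n k (i + 1)
      = weighted m n \<sigma> i \<otimes>\<^bsub>CG m n\<^esub> basis_elt (s_elt m n i)"
    using weighted_covariant[OF m ij(2) s_elt_closed[OF i, of m, unfolded s_elt_def perm_elt_def], of \<sigma>]
    by (simp add: corr_def s_elt_def perm_elt_def \<sigma>_def)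
  then show ?thesis
    using refl_sum_eps[OF m i, of k] unfolding c CG_def ma_mult_add_left ma_simps(4) by simp
qed


section \<open>The change of generators\<close>

text \<open>
  The two sets of relations are compared in an arbitrary algebra under \<open>\<complex>[G]\<close>, so that the result
  applies to both quotients of the free product.
\<close>

locale CG_hom = complex_algebra B for B :: "'b calg" (structure) +
  fixes m n :: nat and \<iota> :: "(gelt \<Rightarrow>\<^sub>0 complex) \<Rightarrow> 'b"
  assumes m: "m \<ge> 1" and iota: "\<iota> \<in> alg_hom (CG m n) B"
begin

interpretation G: group "G_grp m n" by (rule group_G)
interpretation C: complex_algebra "CG m n" by (rule complex_algebra_CG)

abbreviation gam :: "gelt \<Rightarrow> 'b" where "gam x \<equiv> \<iota> (basis_elt x)"

lemma gam_closed: "x \<in> carrier (G_grp m n) \<Longrightarrow> gam x \<in> carrier B"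
  by (intro alg_hom_closed[OF iota] basis_elt_closed)

lemma gam_mult:
  assumes "x \<in> carrier (G_grp m n)" "y \<in> carrier (G_grp m n)"
  shows "gam (x \<otimes>\<^bsub>G_grp m n\<^esub> y) = gam x \<otimes> gam y"
proof -
  have "basis_elt (x \<otimes>\<^bsub>G_grp m n\<^esub> y) = basis_elt x \<otimes>\<^bsub>CG m n\<^esub> basis_elt y"
    by (simp add: CG_def basis_elt_def ma_mult_single)
  then show ?thesis using assms by (simp add: alg_hom_mult[OF iota] basis_elt_closed)
qed

lemma gam_one: "gam \<one>\<^bsub>G_grp m n\<^esub> = \<one>"
  using alg_hom_one[OF iota] by (simp add: CG_def ma_simps basis_elt_def)

lemma iota_plus:
  "\<lbrakk>a \<in> carrier (CG m n); b \<in> carrier (CG m n)\<rbrakk> \<Longrightarrow> \<iota> (a + b) = \<iota> a \<oplus> \<iota> b"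
  using alg_hom_add[OF iota, of a b] by (simp add: CG_def ma_simps)

lemma iota_zero: "\<iota> 0 = \<zero>"
proof -
  have z: "(0 :: gelt \<Rightarrow>\<^sub>0 complex) \<in> carrier (CG m n)" by (simp add: CG_def ma_simps)
  have "\<iota> 0 \<oplus> \<iota> 0 = \<iota> 0" using iota_plus[OF z z] by simp
  then show ?thesis using alg_hom_closed[OF iota z] by simp
qed

lemma gam_s:
  assumes "i \<in> {1..<n}"
  shows "gam (s_elt m n i) \<in> carrier B" "gam (s_elt m n i) \<otimes> gam (s_elt m n i) = \<one>"
    "inv\<^bsub>G_grp m n\<^esub> (s_elt m n i) = s_elt m n i"
proof -
  note s = s_elt_closed[OF assms, of m]
  have ss: "s_elt m n i \<otimes>\<^bsub>G_grp m n\<^esub> s_elt m n i = \<one>\<^bsub>G_grp m n\<^esub>"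
    using assms by (auto simp: s_elt_def perm_elt_def torus_def G_mult G_one fun_eq_iff transpose_def)
  show "gam (s_elt m n i) \<in> carrier B" by (rule gam_closed[OF s])
  show "gam (s_elt m n i) \<otimes> gam (s_elt m n i) = \<one>" using gam_mult[OF s s] ss gam_one by simp
  show "inv\<^bsub>G_grp m n\<^esub> (s_elt m n i) = s_elt m n i" by (rule G.inv_equality[OF ss s s])
qed

text \<open>
  The relations of \<open>H_DO\<close> between the generators and the group; the commutation of the generators
  among themselves is treated separately.
\<close>

definition dunkl_opdam :: "complex \<Rightarrow> (nat \<Rightarrow> 'b) \<Rightarrow> bool" where
  "dunkl_opdam k z \<longleftrightarrow>
     (\<forall>i\<in>{1..n}. \<forall>r\<in>{1..n}. z i \<otimes> gam (g_elt m n r) = gam (g_elt m n r) \<otimes> z i) \<and>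
     (\<forall>i\<in>{1..<n}. \<forall>j\<in>{1..n}. j \<noteq> i \<longrightarrow> j \<noteq> i + 1 \<longrightarrow> z j \<otimes> gam (s_elt m n i) = gam (s_elt m n i) \<otimes> z j) \<and>
     (\<forall>i\<in>{1..<n}. z i \<otimes> gam (s_elt m n i) = gam (s_elt m n i) \<otimes> z (i + 1) \<ominus> k \<odot> \<iota> (eps m n i (i + 1)))"

definition covariant :: "(nat \<Rightarrow> 'b) \<Rightarrow> bool" where
  "covariant y \<longleftrightarrow>
     (\<forall>i\<in>{1..n}. \<forall>r\<in>{1..n}. gam (g_elt m n r) \<otimes> y i = y i \<otimes> gam (g_elt m n r)) \<and>
     (\<forall>i\<in>{1..<n}. \<forall>j\<in>{1..n}. gam (s_elt m n i) \<otimes> y j = y (transpose i (i + 1) j) \<otimes> gam (s_elt m n i))"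

text \<open>
  The relation \<open>s\<^sub>i y\<^sub>i = y\<^sub>i\<^sub>+\<^sub>1 s\<^sub>i\<close> follows from \<open>y\<^sub>i s\<^sub>i = s\<^sub>i y\<^sub>i\<^sub>+\<^sub>1\<close> by multiplying with the involution \<open>s\<^sub>i\<close> on
  both sides. The remaining conditions have the shape of the Dunkl-Opdam relations for \<open>k = 0\<close>.
\<close>

lemma covariant_iff:
  assumes y: "\<And>i. i \<in> {1..n} \<Longrightarrow> y i \<in> carrier B"
  shows "covariant y \<longleftrightarrow>
     (\<forall>i\<in>{1..n}. \<forall>r\<in>{1..n}. y i \<otimes> gam (g_elt m n r) = gam (g_elt m n r) \<otimes> y i) \<and>
     (\<forall>i\<in>{1..<n}. \<forall>j\<in>{1..n}. j \<noteq> i \<longrightarrow> j \<noteq> i + 1 \<longrightarrow> y j \<otimes> gam (s_elt m n i) = gam (s_elt m n i) \<otimes> y j) \<and>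
     (\<forall>i\<in>{1..<n}. y i \<otimes> gam (s_elt m n i) = gam (s_elt m n i) \<otimes> y (i + 1))"
proof -
  have s: "(\<forall>j\<in>{1..n}. gam (s_elt m n i) \<otimes> y j = y (transpose i (i + 1) j) \<otimes> gam (s_elt m n i)) \<longleftrightarrow>
      (\<forall>j\<in>{1..n}. j \<noteq> i \<longrightarrow> j \<noteq> i + 1 \<longrightarrow> y j \<otimes> gam (s_elt m n i) = gam (s_elt m n i) \<otimes> y j) \<and>
      y i \<otimes> gam (s_elt m n i) = gam (s_elt m n i) \<otimes> y (i + 1)" (is "?L \<longleftrightarrow> ?R") if i: "i \<in> {1..<n}" for i
  proof
    have ij: "i \<in> {1..n}" "i + 1 \<in> {1..n}" using i by auto
    assume ?L
    with ij show ?R by (auto simp: transpose_def split: if_splits)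
  next
    have ij: "i \<in> {1..n}" "i + 1 \<in> {1..n}" using i by auto
    note c = gam_s(1)[OF i] y[OF ij(1)] y[OF ij(2)]
    assume R: ?R
    have "gam (s_elt m n i) \<otimes> y i = gam (s_elt m n i) \<otimes> (y i \<otimes> gam (s_elt m n i)) \<otimes> gam (s_elt m n i)"
      using c gam_s(2)[OF i] by (simp add: m_assoc)
    also have "\<dots> = y (i + 1) \<otimes> gam (s_elt m n i)"
      using c gam_s(2)[OF i] R by (simp add: m_assoc[symmetric])
    finally have "gam (s_elt m n i) \<otimes> y i = y (i + 1) \<otimes> gam (s_elt m n i)" .
    then show ?L using R by (auto simp: transpose_def)
  qed
  have "(\<forall>i\<in>{1..<n}. \<forall>j\<in>{1..n}. gam (s_elt m n i) \<otimes> y j = y (transpose i (i + 1) j) \<otimes> gam (s_elt m n i)) \<longleftrightarrow>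
     (\<forall>i\<in>{1..<n}. \<forall>j\<in>{1..n}. j \<noteq> i \<longrightarrow> j \<noteq> i + 1 \<longrightarrow> y j \<otimes> gam (s_elt m n i) = gam (s_elt m n i) \<otimes> y j) \<and>
     (\<forall>i\<in>{1..<n}. y i \<otimes> gam (s_elt m n i) = gam (s_elt m n i) \<otimes> y (i + 1))"
    unfolding ball_conj_distrib[symmetric] by (rule ball_cong[OF refl s])
  then show ?thesis unfolding covariant_def by (simp only: eq_commute[of "gam _ \<otimes> y _"])
qed

lemma corr_in: "i \<in> {1..n} \<Longrightarrow> \<iota> (corr m n k i) \<in> carrier B"
  by (intro alg_hom_closed[OF iota] corr_closed m)

text \<open>
  The correction terms satisfy the same relations with the opposite defect, so adding them cancels
  the \<open>\<epsilon>\<close>-term and changes nothing in the other relations.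
\<close>

lemma dunkl_opdam_iff_covariant:
  assumes z: "\<And>i. i \<in> {1..n} \<Longrightarrow> z i \<in> carrier B"
  shows "dunkl_opdam k z \<longleftrightarrow> covariant (\<lambda>i. z i \<oplus> \<iota> (corr m n k i))"
proof -
  let ?d = "\<lambda>i. \<iota> (corr m n k i)"
  note d = corr_in[of _ k]
  have gc: "gam (g_elt m n r) \<in> carrier B" for r by (rule gam_closed[OF g_elt_closed[OF m]])
  have dist: "(a \<oplus> b) \<otimes> x = x \<otimes> (c \<oplus> d) \<longleftrightarrow> a \<otimes> x = x \<otimes> c"
    if "b \<otimes> x = x \<otimes> d" "a \<in> carrier B" "b \<in> carrier B" "c \<in> carrier B" "d \<in> carrier B" "x \<in> carrier B" for a b c d x
    using that by (simp add: l_distr r_distr)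
  have shift: "(a \<oplus> b) \<otimes> x = x \<otimes> (c \<oplus> d) \<longleftrightarrow> a \<otimes> x = x \<otimes> c \<ominus> e"
    if "b \<otimes> x = x \<otimes> d \<oplus> e" "a \<in> carrier B" "b \<in> carrier B" "c \<in> carrier B" "d \<in> carrier B"
      "e \<in> carrier B" "x \<in> carrier B" for a b c d e x
  proof -
    have "(a \<oplus> b) \<otimes> x = (a \<otimes> x \<oplus> e) \<oplus> x \<otimes> d"
      using that by (simp add: l_distr a_ac)
    moreover have "x \<otimes> (c \<oplus> d) = x \<otimes> c \<oplus> x \<otimes> d"
      using that by (simp add: r_distr)
    ultimately have "(a \<oplus> b) \<otimes> x = x \<otimes> (c \<oplus> d) \<longleftrightarrow> a \<otimes> x \<oplus> e = x \<otimes> c"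
      using that by simp
    also have "\<dots> \<longleftrightarrow> a \<otimes> x = x \<otimes> c \<ominus> e"
    proof
      assume "a \<otimes> x \<oplus> e = x \<otimes> c"
      from this[symmetric] show "a \<otimes> x = x \<otimes> c \<ominus> e"
        using that by (simp add: a_minus_def a_assoc r_neg)
    next
      assume "a \<otimes> x = x \<otimes> c \<ominus> e"
      then show "a \<otimes> x \<oplus> e = x \<otimes> c"
        using that by (simp add: a_minus_def a_assoc l_neg)
    qed
    finally show ?thesis .
  qed
  have bc: "basis_elt (s_elt m n i) \<in> carrier (CG m n)" if "i \<in> {1..<n}" for i
    using s_elt_closed[OF that] by (rule basis_elt_closed)
  have bg: "basis_elt (g_elt m n r) \<in> carrier (CG m n)" for r
    by (rule basis_elt_closed[OF g_elt_closed[OF m]])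
  have 1: "(z i \<oplus> ?d i) \<otimes> gam (g_elt m n r) = gam (g_elt m n r) \<otimes> (z i \<oplus> ?d i) \<longleftrightarrow>
      z i \<otimes> gam (g_elt m n r) = gam (g_elt m n r) \<otimes> z i" if i: "i \<in> {1..n}" for i r
    by (rule dist) (use corr_g[OF m i, of r k] i in
      \<open>simp_all add: alg_hom_mult[OF iota, symmetric] corr_closed[OF m] bg z d gc\<close>)
  have 2: "(z j \<oplus> ?d j) \<otimes> gam (s_elt m n i) = gam (s_elt m n i) \<otimes> (z j \<oplus> ?d j) \<longleftrightarrow>
      z j \<otimes> gam (s_elt m n i) = gam (s_elt m n i) \<otimes> z j"
    if i: "i \<in> {1..<n}" and j: "j \<in> {1..n}" "j \<noteq> i" "j \<noteq> i + 1" for i j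
    by (rule dist) (use corr_s_other[OF m j i, of k] i j in
      \<open>simp_all add: alg_hom_mult[OF iota, symmetric] corr_closed[OF m] bc z d gam_s(1)\<close>)
  have 3: "(z i \<oplus> ?d i) \<otimes> gam (s_elt m n i) = gam (s_elt m n i) \<otimes> (z (i + 1) \<oplus> ?d (i + 1)) \<longleftrightarrow>
      z i \<otimes> gam (s_elt m n i) = gam (s_elt m n i) \<otimes> z (i + 1) \<ominus> k \<odot> \<iota> (eps m n i (i + 1))"
    if i: "i \<in> {1..<n}" for i
  proof -
    have ij: "i \<in> {1..n}" "i + 1 \<in> {1..n}" using i by auto
    let ?s = "gam (s_elt m n i)" and ?e = "k \<odot> \<iota> (eps m n i (i + 1))"
    have ec: "eps m n i (i + 1) \<in> carrier (CG m n)" by (rule eps_closed[OF m])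
    have e: "?e \<in> carrier B" by (intro smult_closed alg_hom_closed[OF iota] ec)
    have "?d i \<otimes> ?s = \<iota> (corr m n k i \<otimes>\<^bsub>CG m n\<^esub> basis_elt (s_elt m n i))"
      using ij bc[OF i] by (simp add: alg_hom_mult[OF iota] corr_closed[OF m])
    also have "\<dots> = ?s \<otimes> ?d (i + 1) \<oplus> ?e"
      unfolding corr_s[OF m i] using ij bc[OF i] ec
      by (simp add: alg_hom_mult[OF iota] alg_hom_add[OF iota] alg_hom_smult[OF iota] corr_closed[OF m]
         C.smult_closed)
    finally have ds: "?d i \<otimes> ?s = ?s \<otimes> ?d (i + 1) \<oplus> ?e" .
    show ?thesis by (rule shift[OF ds z[OF ij(1)] d[OF ij(1)] z[OF ij(2)] d[OF ij(2)] e gam_s(1)[OF i]])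
  qed
  have c: "z i \<oplus> ?d i \<in> carrier B" if "i \<in> {1..n}" for i using z d that by simp
  show ?thesis
    unfolding dunkl_opdam_def
    by (subst covariant_iff[OF c]) (simp_all only: 1 2 3 not_False_eq_True cong: ball_cong imp_cong)
qed

text \<open>
  The group elements that permute the \<open>y\<^sub>q\<close> through their underlying permutation are closed under
  multiplication and contain the generators \<open>s\<^sub>i\<close> and \<open>g\<^sub>i\<close>. Reflections are products of these: a
  transposition is reached by widening the gap between its two points one step at a time.
\<close>

lemma covariant_refl:
  assumes cov: "covariant y" and y: "\<And>i. i \<in> {1..n} \<Longrightarrow> y i \<in> carrier B"
    and ij: "i \<in> {1..n}" "j \<in> {1..n}" "i \<noteq> j" and x: "x \<in> refls m n i j" and q: "q \<in> {1..n}"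
  shows "gam x \<otimes> y q = y (transpose i j q) \<otimes> gam x"
proof -
  define H where "H = {x \<in> carrier (G_grp m n). \<forall>q\<in>{1..n}. gam x \<otimes> y q = y (fst x q) \<otimes> gam x}"
  have mult: "a \<otimes>\<^bsub>G_grp m n\<^esub> b \<in> H" if a: "a \<in> H" and b: "b \<in> H" for a b
  proof -
    have ac: "a \<in> carrier (G_grp m n)" and bc: "b \<in> carrier (G_grp m n)" using a b by (auto simp: H_def)
    have bq: "fst b q \<in> {1..n}" "fst a q \<in> {1..n}" if "q \<in> {1..n}" for q
      using ac bc m that permutes_in_image[of "fst b" "{1..n}" q] permutes_in_image[of "fst a" "{1..n}" q]
      by (cases a; cases b; auto simp: G_carrier_iff)+
    have "gam (a \<otimes>\<^bsub>G_grp m n\<^esub> b) \<otimes> y q = y (fst (a \<otimes>\<^bsub>G_grp m n\<^esub> b) q) \<otimes> gam (a \<otimes>\<^bsub>G_grp m n\<^esub> b)"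
      if q: "q \<in> {1..n}" for q
    proof -
      note c = gam_closed[OF ac] gam_closed[OF bc] y[OF q] y[OF bq(1)[OF q]] y[OF bq(2)[OF bq(1)[OF q]]]
      have "gam a \<otimes> gam b \<otimes> y q = gam a \<otimes> (gam b \<otimes> y q)" using c by (simp add: m_assoc)
      also have "gam b \<otimes> y q = y (fst b q) \<otimes> gam b" using b q by (auto simp: H_def)
      also have "gam a \<otimes> (y (fst b q) \<otimes> gam b) = (gam a \<otimes> y (fst b q)) \<otimes> gam b" using c by (simp add: m_assoc)
      also have "gam a \<otimes> y (fst b q) = y (fst a (fst b q)) \<otimes> gam a" using a bq(1)[OF q] by (auto simp: H_def)
      also have "y (fst a (fst b q)) \<otimes> gam a \<otimes> gam b = y (fst a (fst b q)) \<otimes> (gam a \<otimes> gam b)"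
        using c by (simp add: m_assoc)
      finally show ?thesis using gam_mult[OF ac bc] by (cases a; cases b; simp add: G_mult)
    qed
    then show ?thesis unfolding H_def using ac bc by auto
  qed
  have one: "\<one>\<^bsub>G_grp m n\<^esub> \<in> H"
    unfolding H_def mem_Collect_eq gam_one
    by (intro conjI ballI G.one_closed) (simp add: G_one y)
  have sH: "s_elt m n r \<in> H" if "r \<in> {1..<n}" for r
    using cov s_elt_closed[OF that] that by (simp add: H_def covariant_def s_elt_def perm_elt_def)
  have gH: "g_elt m n r \<in> H" if "r \<in> {1..n}" for r
    using cov g_elt_closed[OF m] that by (simp add: H_def covariant_def) (simp add: g_elt_def)
  have gnat: "g_elt m n r [^]\<^bsub>G_grp m n\<^esub> (a::nat) \<in> H" if "r \<in> {1..n}" for r a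
    by (induct a) (simp_all only: G.nat_pow_0 G.nat_pow_Suc one mult gH[OF that])
  \<comment> \<open>Negative powers are powers with exponent in \<open>{0..<m}\<close>, so closure under products suffices.\<close>
  have gpow: "g_elt m n r [^]\<^bsub>G_grp m n\<^esub> (l::int) \<in> H" if "r \<in> {1..n}" for r l
  proof -
    have "int (nat (l mod int m)) = l mod int m" using m by simp
    then have "g_elt m n r [^]\<^bsub>G_grp m n\<^esub> l = g_elt m n r [^]\<^bsub>G_grp m n\<^esub> nat (l mod int m)"
      by (simp only: int_pow_int[symmetric] g_elt_int_pow[OF m] mod_mod_trivial)
    then show ?thesis using gnat[OF that] by simp
  qed
  have pm: "perm_elt m n v \<otimes>\<^bsub>G_grp m n\<^esub> perm_elt m n w = perm_elt m n (v \<circ> w)" if "w permutes {1..n}" for v w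
    using permutes_in_image[OF that] by (auto simp: perm_elt_def G_mult torus_def fun_eq_iff)
  have tr: "perm_elt m n (transpose a b) \<in> H" if "a < b" "b \<le> n" "1 \<le> a" for a b
    using that
  proof (induct b)
    case (Suc b)
    show ?case
    proof (cases "a = b")
      case True
      then show ?thesis using sH[of a] Suc by (simp add: s_elt_def)
    next
      case False
      then have ab: "perm_elt m n (transpose a b) \<in> H" and b: "b \<in> {1..<n}" using Suc by auto
      have "transpose b (b + 1) \<circ> (transpose a b \<circ> transpose b (b + 1)) = transpose a (Suc b)"
        using False Suc by (auto simp: fun_eq_iff transpose_def)
      moreover have "transpose b (b + 1) permutes {1..n}" "transpose a b permutes {1..n}"
        using b Suc by (auto intro!: permutes_swap_id)
      ultimately have "perm_elt m n (transpose a (Suc b))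
          = s_elt m n b \<otimes>\<^bsub>G_grp m n\<^esub> (perm_elt m n (transpose a b) \<otimes>\<^bsub>G_grp m n\<^esub> s_elt m n b)"
        unfolding s_elt_def by (simp add: pm permutes_compose)
      then show ?thesis using mult sH[OF b] ab by simp
    qed
  qed simp
  have "perm_elt m n (transpose i j) \<in> H"
    using tr[of i j] tr[of j i] ij by (cases "i < j") (auto simp: transpose_commute)
  moreover obtain l where "x = perm_elt m n (transpose i j) \<otimes>\<^bsub>G_grp m n\<^esub>
      (g_elt m n i [^]\<^bsub>G_grp m n\<^esub> int l \<otimes>\<^bsub>G_grp m n\<^esub> g_elt m n j [^]\<^bsub>G_grp m n\<^esub> (- int l))"
    using bij_betw_imp_surj_on[OF refls_param[OF m ij]] x by blast
  ultimately have "x \<in> H" using mult gpow ij by simp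
  moreover have "fst x = transpose i j" using x by (auto simp: refls_def)
  ultimately show ?thesis using q by (auto simp: H_def)
qed

lemma intertwine_sum:
  assumes y: "y \<in> carrier B" "y' \<in> carrier B" and c: "\<And>x. x \<in> X \<Longrightarrow> f x \<in> carrier (CG m n)"
    and e: "\<And>x. x \<in> X \<Longrightarrow> y \<otimes> \<iota> (f x) = \<iota> (f x) \<otimes> y'"
  shows "y \<otimes> \<iota> (sum f X) = \<iota> (sum f X) \<otimes> y'"
  using c e
proof (induct X rule: infinite_finite_induct)
  case (insert x X)
  have "sum f X \<in> carrier (CG m n)" using insert by (intro CG_sum_closed) auto
  then show ?case using insert y
    by (simp add: iota_plus l_distr r_distr alg_hom_closed[OF iota])
qed (use y in \<open>simp_all add: iota_zero\<close>)

lemma covariant_refl_sum: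
  assumes cov: "covariant y" and y: "\<And>i. i \<in> {1..n} \<Longrightarrow> y i \<in> carrier B"
    and ij: "i \<in> {1..n}" "j \<in> {1..n}" "i \<noteq> j" and q: "q \<in> {1..n}"
  shows "y q \<otimes> \<iota> (refl_sum m n c i j) = \<iota> (refl_sum m n c i j) \<otimes> y (transpose i j q)"
  unfolding refl_sum_def
proof (rule intertwine_sum)
  have q': "transpose i j q \<in> {1..n}" using ij q by (auto simp: transpose_def)
  show yc: "y q \<in> carrier B" "y (transpose i j q) \<in> carrier B" using y q q' by blast+
  fix x assume x: "x \<in> refls m n i j"
  then have xc: "x \<in> carrier (G_grp m n)" using refls_closed[OF m ij(1,2)] by blast
  show "Poly_Mapping.single x c \<in> carrier (CG m n)" using xc by (simp add: CG_def ma_simps)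
  have single: "Poly_Mapping.single x c = c \<odot>\<^bsub>CG m n\<^esub> basis_elt x"
    unfolding CG_def ma_simps basis_elt_def
    by (rule poly_mapping_eqI) (simp add: lookup_map_scale lookup_single when_def)
  show "y q \<otimes> \<iota> (Poly_Mapping.single x c) = \<iota> (Poly_Mapping.single x c) \<otimes> y (transpose i j q)"
    unfolding single
    using covariant_refl[OF cov y ij x q'] yc gam_closed[OF xc]
    by (simp add: alg_hom_smult[OF iota] basis_elt_closed[OF xc] smult_mult_left smult_mult_right)
qed

text \<open>
  Only the common summand \<open>E = c e\<^sub>i\<^sub>j\<close> fails to commute with the \<open>y\<close> in question. It occurs in the
  two correction terms with opposite signs and exchanges \<open>y\<^sub>i\<close> and \<open>y\<^sub>j\<close>, so its contributions cancel.
\<close>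

lemma cross_terms:
  assumes cov: "covariant y" and y: "\<And>i. i \<in> {1..n} \<Longrightarrow> y i \<in> carrier B"
    and ij: "i \<in> {1..n}" "j \<in> {1..n}"
  shows "y i \<otimes> \<iota> (corr m n k j) \<oplus> \<iota> (corr m n k i) \<otimes> y j
    = \<iota> (corr m n k j) \<otimes> y i \<oplus> y j \<otimes> \<iota> (corr m n k i)"
proof (cases "i = j")
  case True
  then show ?thesis using y ij corr_in by (simp add: a_comm)
next
  case False
  define rest where "rest a b = (\<Sum>l\<in>{1..n} - {b}. refl_sum m n (k / 2 * of_int (sgn (int l - int a))) a l)" for a b
  define c where "c = k / 2 * of_int (sgn (int i - int j))"
  have c': "k / 2 * of_int (sgn (int j - int i)) = - c" by (simp add: c_def sgn_if)
  have restc: "rest a b \<in> carrier (CG m n)" if "a \<in> {1..n}" for a b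
    unfolding rest_def using that by (intro CG_sum_closed refl_sum_closed m) auto
  have comm: "y b \<otimes> \<iota> (rest a b) = \<iota> (rest a b) \<otimes> y b" if ab: "a \<in> {1..n}" "b \<in> {1..n}" "a \<noteq> b" for a b
    unfolding rest_def
  proof (rule intertwine_sum)
    fix l assume l: "l \<in> {1..n} - {b}"
    show "y b \<otimes> \<iota> (refl_sum m n (k / 2 * of_int (sgn (int l - int a))) a l)
        = \<iota> (refl_sum m n (k / 2 * of_int (sgn (int l - int a))) a l) \<otimes> y b"
    \<comment> \<open>The term with \<open>l = a\<close> does not sum over reflections, but its weight is \<open>0\<close>.\<close>
    proof (cases "l = a")
      case True
      then show ?thesis using y[OF ab(2)] by (simp add: refl_sum_zero iota_zero)
    next
      case False
      then show ?thesis using covariant_refl_sum[OF cov y ab(1) _ _ ab(2), of l] l ab by simp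
    qed
  qed (use ab y m in \<open>auto intro: refl_sum_closed\<close>)
  let ?E = "\<iota> (refl_sum m n c j i)"
  have Ec: "?E \<in> carrier B" by (intro alg_hom_closed[OF iota] refl_sum_closed m ij)
  have dj: "\<iota> (corr m n k j) = ?E \<oplus> \<iota> (rest j i)"
  proof -
    have "corr m n k j = refl_sum m n c j i + rest j i"
      unfolding corr_def weighted_def rest_def c_def using ij by (subst sum.remove[of _ i]) auto
    then show ?thesis using ij by (simp add: iota_plus refl_sum_closed[OF m] restc)
  qed
  have di: "\<iota> (corr m n k i) = \<ominus> ?E \<oplus> \<iota> (rest i j)"
  proof -
    have "refl_sum m n c j i + refl_sum m n (- c) i j = 0"
      using refl_sum_add[of m n c "- c" i j] by (simp add: refl_sum_commute[of m n c j i] refl_sum_zero)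
    then have "?E \<oplus> \<iota> (refl_sum m n (- c) i j) = \<zero>"
      using ij iota_zero by (simp add: iota_plus[symmetric] refl_sum_closed[OF m])
    then have "\<iota> (refl_sum m n (- c) i j) = \<ominus> ?E"
      using Ec alg_hom_closed[OF iota refl_sum_closed[OF m ij, of "- c"]]
      by (metis a_comm minus_equality)
    moreover have "corr m n k i = refl_sum m n (- c) i j + rest i j"
      unfolding corr_def weighted_def rest_def c'[symmetric] using ij by (subst sum.remove[of _ j]) auto
    ultimately show ?thesis using ij by (simp add: iota_plus refl_sum_closed[OF m] restc)
  qed
  have swap: "y i \<otimes> ?E = ?E \<otimes> y j" "y j \<otimes> ?E = ?E \<otimes> y i"
    using covariant_refl_sum[OF cov y ij(2,1) False[symmetric] ij(1), of c]
      covariant_refl_sum[OF cov y ij(2,1) False[symmetric] ij(2), of c] by simp_all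
  define P Q where "P = \<iota> (rest j i)" and "Q = \<iota> (rest i j)"
  have PQ: "P \<in> carrier B" "Q \<in> carrier B"
    unfolding P_def Q_def by (intro alg_hom_closed[OF iota] restc ij)+
  have com: "y i \<otimes> P = P \<otimes> y i" "y j \<otimes> Q = Q \<otimes> y j"
    unfolding P_def Q_def using comm[of j i] comm[of i j] ij False by auto
  note cl = PQ Ec y[OF ij(1)] y[OF ij(2)]
  have "y i \<otimes> (?E \<oplus> P) \<oplus> (\<ominus> ?E \<oplus> Q) \<otimes> y j = (?E \<otimes> y j \<oplus> P \<otimes> y i) \<oplus> (\<ominus> (?E \<otimes> y j) \<oplus> Q \<otimes> y j)"
    using cl by (simp add: r_distr l_distr swap com l_minus)
  also have "\<dots> = P \<otimes> y i \<oplus> Q \<otimes> y j"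
    using cl by algebra
  also have "\<dots> = (?E \<otimes> y i \<oplus> P \<otimes> y i) \<oplus> (\<ominus> (?E \<otimes> y i) \<oplus> Q \<otimes> y j)"
    using cl by algebra
  also have "\<dots> = (?E \<oplus> P) \<otimes> y i \<oplus> y j \<otimes> (\<ominus> ?E \<oplus> Q)"
    using cl by (simp add: r_distr l_distr swap com r_minus)
  finally show ?thesis unfolding di dj P_def[symmetric] Q_def[symmetric] .
qed

text \<open>
  Expanding \<open>(z\<^sub>i + D\<^sub>i)(z\<^sub>j + D\<^sub>j)\<close> in both orders produces the same mixed terms, by \<open>cross_terms\<close>;
  cancelling them leaves the commutator of the \<open>z\<close> and that of the \<open>D\<close>.
\<close>

lemma commute_iff:
  assumes cov: "covariant (\<lambda>i. z i \<oplus> \<iota> (corr m n k i))" and z: "\<And>i. i \<in> {1..n} \<Longrightarrow> z i \<in> carrier B"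
    and ij: "i \<in> {1..n}" "j \<in> {1..n}"
  shows "z i \<otimes> z j = z j \<otimes> z i \<longleftrightarrow>
    (z i \<oplus> \<iota> (corr m n k i)) \<otimes> (z j \<oplus> \<iota> (corr m n k j)) \<ominus>
    (z j \<oplus> \<iota> (corr m n k j)) \<otimes> (z i \<oplus> \<iota> (corr m n k i))
    = \<iota> ((corr m n k j \<otimes>\<^bsub>CG m n\<^esub> corr m n k i) \<ominus>\<^bsub>CG m n\<^esub> (corr m n k i \<otimes>\<^bsub>CG m n\<^esub> corr m n k j))"
proof -
  let ?di = "\<iota> (corr m n k i)" and ?dj = "\<iota> (corr m n k j)"
  let ?a = "z i \<oplus> ?di" and ?b = "z j \<oplus> ?dj"
  note cl = z[OF ij(1)] z[OF ij(2)] corr_in[OF ij(1), of k] corr_in[OF ij(2), of k]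
  note cc = corr_closed[OF m ij(1), of k] corr_closed[OF m ij(2), of k]
  have p: "\<iota> ((corr m n k j \<otimes>\<^bsub>CG m n\<^esub> corr m n k i) \<ominus>\<^bsub>CG m n\<^esub> (corr m n k i \<otimes>\<^bsub>CG m n\<^esub> corr m n k j))
      = ?dj \<otimes> ?di \<ominus> ?di \<otimes> ?dj"
    using cc by (simp add: alg_hom_minus[OF C.ring_axioms ring_axioms iota] alg_hom_mult[OF iota])
  have "?a \<otimes> ?dj \<oplus> ?di \<otimes> ?b = ?dj \<otimes> ?a \<oplus> ?b \<otimes> ?di"
    by (rule cross_terms[OF cov _ ij]) (simp add: z corr_in)
  note cross = this
  have ab: "?a \<otimes> ?b \<oplus> ?di \<otimes> ?dj = z i \<otimes> z j \<oplus> (?a \<otimes> ?dj \<oplus> ?di \<otimes> ?b)"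
    using cl by (simp add: l_distr r_distr a_ac)
  have ba: "?b \<otimes> ?a \<oplus> ?dj \<otimes> ?di = z j \<otimes> z i \<oplus> (?a \<otimes> ?dj \<oplus> ?di \<otimes> ?b)"
    unfolding cross using cl by (simp add: l_distr r_distr a_ac)
  have cancel: "s = t \<longleftrightarrow> p \<ominus> q = v \<ominus> u"
    if e: "p \<oplus> u = s \<oplus> x" "q \<oplus> v = t \<oplus> x"
      and c: "p \<in> carrier B" "q \<in> carrier B" "s \<in> carrier B" "t \<in> carrier B" "u \<in> carrier B"
        "v \<in> carrier B" "x \<in> carrier B" for p q s t u v x
  proof -
    have "s = t \<longleftrightarrow> p \<oplus> u = q \<oplus> v" using e c by simp
    also have "p \<oplus> u = (p \<ominus> q) \<oplus> (q \<oplus> u)" using c by algebra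
    also have "q \<oplus> v = (v \<ominus> u) \<oplus> (q \<oplus> u)" using c by algebra
    finally show ?thesis using c by simp
  qed
  show ?thesis
    unfolding p by (rule cancel[OF ab ba]; intro m_closed a_closed cl)
qed

end

section \<open>Comparison of the two presentations\<close>

text \<open>
  A homomorphism \<open>h\<close> out of the free product respects a set of relations precisely when the images \<open>y\<^sub>i\<close> of
  the generators satisfy the corresponding identities in \<open>B\<close>.
\<close>

context
  fixes B :: "'b calg" and m n :: nat and \<iota> :: "(gelt \<Rightarrow>\<^sub>0 complex) \<Rightarrow> 'b" and h :: "CG_adj \<Rightarrow> 'b" and y
  assumes B: "CG_hom B m n \<iota>" and h: "h \<in> alg_hom (CG_free m n) B"
    and hA: "\<And>a. a \<in> carrier (CG m n) \<Longrightarrow> h (CG_in m n a) = \<iota> a"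
    and hV: "\<And>i. i \<in> {1..n} \<Longrightarrow> h (Z_in m n i) = y i"
begin

interpretation B: CG_hom B m n \<iota> by (rule B)
interpretation F: complex_algebra "CG_free m n"
  by (intro complex_algebra_adjoin complex_algebra_CG)

lemma relation_terms_closed:
  "i \<in> {1..n} \<Longrightarrow> Z_in m n i \<in> carrier (CG_free m n)"
  "G_in m n (g_elt m n r) \<in> carrier (CG_free m n)"
  "i \<in> {1..<n} \<Longrightarrow> G_in m n (s_elt m n i) \<in> carrier (CG_free m n)"
  "CG_in m n (eps m n i j) \<in> carrier (CG_free m n)"
  by (auto intro!: adj_gen_closed adj_base_closed complex_algebra_CG basis_elt_closed
      g_elt_closed s_elt_closed eps_closed B.m)

lemma hom_relation_terms:
  "h (G_in m n (g_elt m n r)) = \<iota> (basis_elt (g_elt m n r))"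
  "i \<in> {1..<n} \<Longrightarrow> h (G_in m n (s_elt m n i)) = \<iota> (basis_elt (s_elt m n i))"
  "h (CG_in m n (eps m n i j)) = \<iota> (eps m n i j)"
  by (simp_all only: hA basis_elt_closed g_elt_closed[OF B.m] s_elt_closed eps_closed[OF B.m])

lemma ball_pairs:
  fixes f f' :: "nat \<Rightarrow> nat \<Rightarrow> CG_adj"
  shows "(\<forall>(l, r) \<in> {(f i j, f' i j) |i j. P i j}. h l = h r) \<longleftrightarrow> (\<forall>i j. P i j \<longrightarrow> h (f i j) = h (f' i j))"
  by blast

lemma DO_relations_respect_iff:
  "(\<forall>(l, r) \<in> DO_relations m n k. h l = h r) \<longleftrightarrow>
    (\<forall>i\<in>{1..n}. \<forall>j\<in>{1..n}. y i \<otimes>\<^bsub>B\<^esub> y j = y j \<otimes>\<^bsub>B\<^esub> y i) \<and> B.dunkl_opdam k y"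
proof -
  have singles: "(\<forall>(l, r) \<in> {(f i, f' i) |i. P i}. h l = h r) \<longleftrightarrow> (\<forall>i. P i \<longrightarrow> h (f i) = h (f' i))"
    for f f' :: "nat \<Rightarrow> CG_adj" and P
    by blast
  have i: "i \<in> {1..n}" "i + 1 \<in> {1..n}" if "i \<in> {1..<n}" for i using that by auto
  note hom = alg_hom_mult[OF h] alg_hom_minus[OF F.ring_axioms B.ring_axioms h] alg_hom_smult[OF h]
    relation_terms_closed hom_relation_terms hV F.smult_closed
  have zz: "h (Z_in m n i \<otimes>\<^bsub>CG_free m n\<^esub> Z_in m n j) = y i \<otimes>\<^bsub>B\<^esub> y j" if "i \<in> {1..n}" "j \<in> {1..n}" for i j
    using that by (simp only: hom)
  have zg: "h (Z_in m n i \<otimes>\<^bsub>CG_free m n\<^esub> G_in m n (g_elt m n r)) = y i \<otimes>\<^bsub>B\<^esub> B.gam (g_elt m n r)"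
      "h (G_in m n (g_elt m n r) \<otimes>\<^bsub>CG_free m n\<^esub> Z_in m n i) = B.gam (g_elt m n r) \<otimes>\<^bsub>B\<^esub> y i" if "i \<in> {1..n}" for i r
    using that by (simp_all only: hom)
  have zs: "h (Z_in m n j \<otimes>\<^bsub>CG_free m n\<^esub> G_in m n (s_elt m n i)) = y j \<otimes>\<^bsub>B\<^esub> B.gam (s_elt m n i)"
      "h (G_in m n (s_elt m n i) \<otimes>\<^bsub>CG_free m n\<^esub> Z_in m n j) = B.gam (s_elt m n i) \<otimes>\<^bsub>B\<^esub> y j"
    if "i \<in> {1..<n}" "j \<in> {1..n}" for i j
    using that by (simp_all only: hom)
  have ze: "h ((G_in m n (s_elt m n i) \<otimes>\<^bsub>CG_free m n\<^esub> Z_in m n (i + 1)) \<ominus>\<^bsub>CG_free m n\<^esub>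
        (k \<odot>\<^bsub>CG_free m n\<^esub> CG_in m n (eps m n i (i + 1))))
      = (B.gam (s_elt m n i) \<otimes>\<^bsub>B\<^esub> y (i + 1)) \<ominus>\<^bsub>B\<^esub> (k \<odot>\<^bsub>B\<^esub> \<iota> (eps m n i (i + 1)))"
    if "i \<in> {1..<n}" for i
    using that i[OF that] by (simp only: hom F.m_closed)
  have 1: "(\<forall>i j. i \<in> {1..n} \<and> j \<in> {1..n} \<longrightarrow>
        h (Z_in m n i \<otimes>\<^bsub>CG_free m n\<^esub> Z_in m n j) = h (Z_in m n j \<otimes>\<^bsub>CG_free m n\<^esub> Z_in m n i)) \<longleftrightarrow>
      (\<forall>i\<in>{1..n}. \<forall>j\<in>{1..n}. y i \<otimes>\<^bsub>B\<^esub> y j = y j \<otimes>\<^bsub>B\<^esub> y i)"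
    using zz by metis
  have 2: "(\<forall>i r. i \<in> {1..n} \<and> r \<in> {1..n} \<longrightarrow>
        h (Z_in m n i \<otimes>\<^bsub>CG_free m n\<^esub> G_in m n (g_elt m n r)) = h (G_in m n (g_elt m n r) \<otimes>\<^bsub>CG_free m n\<^esub> Z_in m n i)) \<longleftrightarrow>
      (\<forall>i\<in>{1..n}. \<forall>r\<in>{1..n}. y i \<otimes>\<^bsub>B\<^esub> B.gam (g_elt m n r) = B.gam (g_elt m n r) \<otimes>\<^bsub>B\<^esub> y i)"
    using zg by metis
  have 3: "(\<forall>i j. i \<in> {1..<n} \<and> j \<in> {1..n} \<and> j \<noteq> i \<and> j \<noteq> i + 1 \<longrightarrow>
        h (Z_in m n j \<otimes>\<^bsub>CG_free m n\<^esub> G_in m n (s_elt m n i)) = h (G_in m n (s_elt m n i) \<otimes>\<^bsub>CG_free m n\<^esub> Z_in m n j)) \<longleftrightarrow>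
      (\<forall>i\<in>{1..<n}. \<forall>j\<in>{1..n}. j \<noteq> i \<longrightarrow> j \<noteq> i + 1 \<longrightarrow>
        y j \<otimes>\<^bsub>B\<^esub> B.gam (s_elt m n i) = B.gam (s_elt m n i) \<otimes>\<^bsub>B\<^esub> y j)"
    using zs by metis
  have 4: "(\<forall>i. i \<in> {1..<n} \<longrightarrow> h (Z_in m n i \<otimes>\<^bsub>CG_free m n\<^esub> G_in m n (s_elt m n i)) =
        h ((G_in m n (s_elt m n i) \<otimes>\<^bsub>CG_free m n\<^esub> Z_in m n (i + 1)) \<ominus>\<^bsub>CG_free m n\<^esub>
          (k \<odot>\<^bsub>CG_free m n\<^esub> CG_in m n (eps m n i (i + 1))))) \<longleftrightarrow>
      (\<forall>i\<in>{1..<n}. y i \<otimes>\<^bsub>B\<^esub> B.gam (s_elt m n i)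
        = (B.gam (s_elt m n i) \<otimes>\<^bsub>B\<^esub> y (i + 1)) \<ominus>\<^bsub>B\<^esub> (k \<odot>\<^bsub>B\<^esub> \<iota> (eps m n i (i + 1))))"
    using zs(1)[OF _ i(1)] ze by metis
  show ?thesis
    unfolding DO_relations_def Let_def ball_Un ball_pairs singles B.dunkl_opdam_def 1 2 3 4
    by (simp only: conj_assoc)
qed

lemma tilde_relations_respect_iff:
  assumes p: "\<And>i j. i \<in> {1..n} \<Longrightarrow> j \<in> {1..n} \<Longrightarrow> p i j \<in> carrier (CG m n)"
  shows "(\<forall>(l, r) \<in> tilde_relations m n p. h l = h r) \<longleftrightarrow> B.covariant y \<and>
    (\<forall>i\<in>{1..n}. \<forall>j\<in>{1..n}. (y i \<otimes>\<^bsub>B\<^esub> y j) \<ominus>\<^bsub>B\<^esub> (y j \<otimes>\<^bsub>B\<^esub> y i) = \<iota> (p i j))"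
proof -
  note hom = alg_hom_mult[OF h] alg_hom_minus[OF F.ring_axioms B.ring_axioms h] alg_hom_smult[OF h]
    relation_terms_closed hom_relation_terms hV F.m_closed
  have conj: "h (G_in m n (s_elt m n i) \<otimes>\<^bsub>CG_free m n\<^esub> Z_in m n j \<otimes>\<^bsub>CG_free m n\<^esub>
          G_in m n (inv\<^bsub>G_grp m n\<^esub> (s_elt m n i))) = h (Z_in m n (transpose i (i + 1) j)) \<longleftrightarrow>
      B.gam (s_elt m n i) \<otimes>\<^bsub>B\<^esub> y j = y (transpose i (i + 1) j) \<otimes>\<^bsub>B\<^esub> B.gam (s_elt m n i)"
    if i: "i \<in> {1..<n}" and j: "j \<in> {1..n}" for i j
  proof -
    have t: "transpose i (i + 1) j \<in> {1..n}" using i j by (auto simp: transpose_def)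
    have yc: "y q \<in> carrier B" if "q \<in> {1..n}" for q
      using alg_hom_closed[OF h relation_terms_closed(1)[OF that]] hV[OF that] by simp
    have unit: "a \<otimes>\<^bsub>B\<^esub> x = b \<longleftrightarrow> a = b \<otimes>\<^bsub>B\<^esub> x"
      if "x \<otimes>\<^bsub>B\<^esub> x = \<one>\<^bsub>B\<^esub>" "x \<in> carrier B" "a \<in> carrier B" "b \<in> carrier B" for a b x
      using that by (metis B.m_assoc B.r_one)
    have "h (G_in m n (s_elt m n i) \<otimes>\<^bsub>CG_free m n\<^esub> Z_in m n j \<otimes>\<^bsub>CG_free m n\<^esub>
          G_in m n (inv\<^bsub>G_grp m n\<^esub> (s_elt m n i))) = B.gam (s_elt m n i) \<otimes>\<^bsub>B\<^esub> y j \<otimes>\<^bsub>B\<^esub> B.gam (s_elt m n i)"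
      unfolding B.gam_s(3)[OF i] using i j by (simp only: hom)
    then show ?thesis
      using unit[OF B.gam_s(2,1)[OF i] B.m_closed[OF B.gam_s(1)[OF i] yc[OF j]] yc[OF t]] hV[OF t] by simp
  qed
  have zg: "h (Z_in m n i \<otimes>\<^bsub>CG_free m n\<^esub> G_in m n (g_elt m n r)) = y i \<otimes>\<^bsub>B\<^esub> B.gam (g_elt m n r)"
      "h (G_in m n (g_elt m n r) \<otimes>\<^bsub>CG_free m n\<^esub> Z_in m n i) = B.gam (g_elt m n r) \<otimes>\<^bsub>B\<^esub> y i" if "i \<in> {1..n}" for i r
    using that by (simp_all only: hom)
  have zz: "h ((Z_in m n i \<otimes>\<^bsub>CG_free m n\<^esub> Z_in m n j) \<ominus>\<^bsub>CG_free m n\<^esub> (Z_in m n j \<otimes>\<^bsub>CG_free m n\<^esub> Z_in m n i))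
      = (y i \<otimes>\<^bsub>B\<^esub> y j) \<ominus>\<^bsub>B\<^esub> (y j \<otimes>\<^bsub>B\<^esub> y i)" if "i \<in> {1..n}" "j \<in> {1..n}" for i j
    using that by (simp only: hom)
  have 1: "(\<forall>i j. i \<in> {1..<n} \<and> j \<in> {1..n} \<longrightarrow>
        h (G_in m n (s_elt m n i) \<otimes>\<^bsub>CG_free m n\<^esub> Z_in m n j \<otimes>\<^bsub>CG_free m n\<^esub>
          G_in m n (inv\<^bsub>G_grp m n\<^esub> (s_elt m n i))) = h (Z_in m n (transpose i (i + 1) j))) \<longleftrightarrow>
      (\<forall>i\<in>{1..<n}. \<forall>j\<in>{1..n}. B.gam (s_elt m n i) \<otimes>\<^bsub>B\<^esub> y j
        = y (transpose i (i + 1) j) \<otimes>\<^bsub>B\<^esub> B.gam (s_elt m n i))"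
    using conj by metis
  have 2: "(\<forall>i j. i \<in> {1..n} \<and> j \<in> {1..n} \<longrightarrow>
        h (G_in m n (g_elt m n i) \<otimes>\<^bsub>CG_free m n\<^esub> Z_in m n j) = h (Z_in m n j \<otimes>\<^bsub>CG_free m n\<^esub> G_in m n (g_elt m n i))) \<longleftrightarrow>
      (\<forall>i\<in>{1..n}. \<forall>r\<in>{1..n}. B.gam (g_elt m n r) \<otimes>\<^bsub>B\<^esub> y i = y i \<otimes>\<^bsub>B\<^esub> B.gam (g_elt m n r))"
    using zg by metis
  have 3: "(\<forall>i j. i \<in> {1..n} \<and> j \<in> {1..n} \<longrightarrow>
        h ((Z_in m n i \<otimes>\<^bsub>CG_free m n\<^esub> Z_in m n j) \<ominus>\<^bsub>CG_free m n\<^esub> (Z_in m n j \<otimes>\<^bsub>CG_free m n\<^esub> Z_in m n i))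
          = h (CG_in m n (p i j))) \<longleftrightarrow>
      (\<forall>i\<in>{1..n}. \<forall>j\<in>{1..n}. (y i \<otimes>\<^bsub>B\<^esub> y j) \<ominus>\<^bsub>B\<^esub> (y j \<otimes>\<^bsub>B\<^esub> y i) = \<iota> (p i j))"
    using zz hA[OF p] by metis
  show ?thesis
    unfolding tilde_relations_def Let_def ball_Un ball_pairs B.covariant_def 1 2 3
    by blast
qed

end

text \<open>
  The elements \<open>p\<^sub>i\<^sub>j\<close>: the commutators \<open>[D\<^sub>j, D\<^sub>i]\<close>, in this order because
  \<open>0 = [z\<^sub>i, z\<^sub>j] = [y\<^sub>i, y\<^sub>j] + [D\<^sub>i, D\<^sub>j]\<close>.
\<close>

definition corr_commutator :: "nat \<Rightarrow> nat \<Rightarrow> complex \<Rightarrow> nat \<Rightarrow> nat \<Rightarrow> gelt \<Rightarrow>\<^sub>0 complex" where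
  "corr_commutator m n k i j =
     (corr m n k j \<otimes>\<^bsub>CG m n\<^esub> corr m n k i) \<ominus>\<^bsub>CG m n\<^esub> (corr m n k i \<otimes>\<^bsub>CG m n\<^esub> corr m n k j)"

lemma corr_commutator_closed:
  assumes "m \<ge> 1" "i \<in> {1..n}" "j \<in> {1..n}" shows "corr_commutator m n k i j \<in> carrier (CG m n)"
proof -
  interpret C: complex_algebra "CG m n" by (rule complex_algebra_CG)
  show ?thesis unfolding corr_commutator_def using assms by (intro C.minus_closed C.m_closed corr_closed)
qed

text \<open>
  The identities of \<open>dunkl_opdam_iff_covariant\<close> and \<open>commute_iff\<close>, in terms of evaluations of the
  free product: \<open>h'\<close> is \<open>h\<close> after the change of generators.
\<close>

lemma DO_iff_tilde:
  assumes m: "m \<ge> 1" and B: "complex_algebra B"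
    and h: "h \<in> alg_hom (CG_free m n) B" and h': "h' \<in> alg_hom (CG_free m n) B"
    and hA: "\<And>a. a \<in> carrier (CG m n) \<Longrightarrow> h' (CG_in m n a) = h (CG_in m n a)"
    and hV: "\<And>i. i \<in> {1..n} \<Longrightarrow> h' (Z_in m n i) = h (Z_in m n i) \<oplus>\<^bsub>B\<^esub> h (CG_in m n (corr m n k i))"
  shows "(\<forall>(l, r) \<in> DO_relations m n k. h l = h r) \<longleftrightarrow>
    (\<forall>(l, r) \<in> tilde_relations m n (corr_commutator m n k). h' l = h' r)"
proof -
  have CG: "CG_hom B m n (\<lambda>a. h (CG_in m n a))"
    using m B alg_hom_comp[OF adj_base_hom[OF complex_algebra_CG] h]
    by (intro CG_hom.intro CG_hom_axioms.intro)
  interpret B: CG_hom B m n "\<lambda>a. h (CG_in m n a)" by (rule CG)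
  have z: "h (Z_in m n i) \<in> carrier B" if "i \<in> {1..n}" for i
    using alg_hom_closed[OF h adj_gen_closed[OF complex_algebra_CG that]] .
  let ?y = "\<lambda>i. h (Z_in m n i) \<oplus>\<^bsub>B\<^esub> h (CG_in m n (corr m n k i))"
  have "(\<forall>(l, r) \<in> DO_relations m n k. h l = h r) \<longleftrightarrow>
      (\<forall>i\<in>{1..n}. \<forall>j\<in>{1..n}. h (Z_in m n i) \<otimes>\<^bsub>B\<^esub> h (Z_in m n j) = h (Z_in m n j) \<otimes>\<^bsub>B\<^esub> h (Z_in m n i)) \<and>
      B.dunkl_opdam k (\<lambda>i. h (Z_in m n i))"
    by (rule DO_relations_respect_iff[OF CG h]) auto
  also have "\<dots> \<longleftrightarrow> B.covariant ?y \<and>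
      (\<forall>i\<in>{1..n}. \<forall>j\<in>{1..n}. (?y i \<otimes>\<^bsub>B\<^esub> ?y j) \<ominus>\<^bsub>B\<^esub> (?y j \<otimes>\<^bsub>B\<^esub> ?y i) = h (CG_in m n (corr_commutator m n k i j)))"
  proof -
    have "B.dunkl_opdam k (\<lambda>i. h (Z_in m n i)) \<longleftrightarrow> B.covariant ?y"
      by (rule B.dunkl_opdam_iff_covariant[OF z])
    moreover
    have "h (Z_in m n i) \<otimes>\<^bsub>B\<^esub> h (Z_in m n j) = h (Z_in m n j) \<otimes>\<^bsub>B\<^esub> h (Z_in m n i) \<longleftrightarrow>
        (?y i \<otimes>\<^bsub>B\<^esub> ?y j) \<ominus>\<^bsub>B\<^esub> (?y j \<otimes>\<^bsub>B\<^esub> ?y i) = h (CG_in m n (corr_commutator m n k i j))"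
      if "B.covariant ?y" "i \<in> {1..n}" "j \<in> {1..n}" for i j
      unfolding corr_commutator_def by (rule B.commute_iff[OF that(1) z that(2,3)])
    then have "(\<forall>i\<in>{1..n}. \<forall>j\<in>{1..n}. h (Z_in m n i) \<otimes>\<^bsub>B\<^esub> h (Z_in m n j) = h (Z_in m n j) \<otimes>\<^bsub>B\<^esub> h (Z_in m n i)) \<longleftrightarrow>
        (\<forall>i\<in>{1..n}. \<forall>j\<in>{1..n}. (?y i \<otimes>\<^bsub>B\<^esub> ?y j) \<ominus>\<^bsub>B\<^esub> (?y j \<otimes>\<^bsub>B\<^esub> ?y i) = h (CG_in m n (corr_commutator m n k i j)))"
      if "B.covariant ?y" using that by (intro ball_cong refl)
    ultimately show ?thesis by blast
  qed
  also have "\<dots> \<longleftrightarrow> (\<forall>(l, r) \<in> tilde_relations m n (corr_commutator m n k). h' l = h' r)"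
    by (rule tilde_relations_respect_iff[OF CG h' hA hV corr_commutator_closed[OF m], symmetric])
  finally show ?thesis .
qed

theorem theorem4p13:
  fixes m n :: nat and k :: complex
  assumes "m \<ge> 1" and "n \<ge> 1"
  shows "\<exists>zt p.
    (\<forall>i\<in>{1..n}. zt i \<in> carrier (H_DO m n k)) \<and>
    (\<forall>i\<in>{1..n}. \<forall>j\<in>{1..n}. p i j \<in> carrier (CG m n)) \<and>
    presented_by (H_DO m n k) (CG m n) (H_DO_base m n k) {1..n} zt (tilde_relations m n p)"
proof -
  let ?F = "CG_free m n" and ?R = "DO_relations m n k" and ?T = "tilde_relations m n (corr_commutator m n k)"
  let ?q = "quot_proj ?F ?R" and ?q' = "quot_proj ?F ?T"
  note m = assms(1) and C = complex_algebra_CG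
  interpret F: complex_algebra ?F by (intro complex_algebra_adjoin C)
  note F = F.complex_algebra_axioms
  note R = DO_relations_closed[OF m, of n k]
  have T: "?T \<subseteq> carrier ?F \<times> carrier ?F"
    by (rule tilde_relations_closed[OF m corr_commutator_closed[OF m]])
  have z: "Z_in m n i \<in> carrier ?F" if "i \<in> {1..n}" for i by (rule adj_gen_closed[OF C that])
  have d: "CG_in m n (corr m n k i) \<in> carrier ?F" if "i \<in> {1..n}" for i
    by (intro adj_base_closed[OF C] corr_closed m that)
  note Q = complex_algebra_quot[OF F R] complex_algebra_quot[OF F T]
  note q = quot_proj_hom[OF F R] quot_proj_hom[OF F T]
  have pres: "presented_by (quot_alg ?F ?R) (CG m n) (\<lambda>a. ?q (CG_in m n a)) {1..n}
    (\<lambda>i. ?q (Z_in m n i \<oplus>\<^bsub>?F\<^esub> CG_in m n (corr m n k i))) ?T"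
  proof (rule presented_by_translate[OF C R T corr_closed[OF m]])
    fix h l r
    assume h: "h \<in> alg_hom ?F (quot_alg ?F ?R)"
      and hA: "\<And>a. a \<in> carrier (CG m n) \<Longrightarrow> h (CG_in m n a) = ?q (CG_in m n a)"
      and hV: "\<And>i. i \<in> {1..n} \<Longrightarrow> h (Z_in m n i) = ?q (Z_in m n i \<oplus>\<^bsub>?F\<^esub> CG_in m n (corr m n k i))"
      and lr: "(l, r) \<in> ?T"
    have "\<forall>(l, r) \<in> ?R. ?q l = ?q r" using quot_proj_rel[OF F R] by blast
    then have "\<forall>(l, r) \<in> ?T. h l = h r"
      by (subst DO_iff_tilde[OF m Q(1) q(1) h, symmetric]) (simp_all only: hA hV alg_hom_add[OF q(1)] z d)
    with lr show "h l = h r" by blast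
  next
    fix h l r
    assume h: "h \<in> alg_hom ?F (quot_alg ?F ?T)"
      and hA: "\<And>a. a \<in> carrier (CG m n) \<Longrightarrow> h (CG_in m n a) = ?q' (CG_in m n a)"
      and hV: "\<And>i. i \<in> {1..n} \<Longrightarrow> h (Z_in m n i) = ?q' (Z_in m n i \<ominus>\<^bsub>?F\<^esub> CG_in m n (corr m n k i))"
      and lr: "(l, r) \<in> ?R"
    have "?q' (Z_in m n i) = h (Z_in m n i) \<oplus>\<^bsub>quot_alg ?F ?T\<^esub> h (CG_in m n (corr m n k i))" if i: "i \<in> {1..n}" for i
    proof -
      have "Z_in m n i = (Z_in m n i \<ominus>\<^bsub>?F\<^esub> CG_in m n (corr m n k i)) \<oplus>\<^bsub>?F\<^esub> CG_in m n (corr m n k i)"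
        using z[OF i] d[OF i] by (simp only: a_minus_def F.a_assoc F.l_neg F.a_inv_closed F.r_zero)
      then have "?q' (Z_in m n i) = ?q' (\<dots>)" by (rule arg_cong)
      also have "\<dots> = ?q' (Z_in m n i \<ominus>\<^bsub>?F\<^esub> CG_in m n (corr m n k i)) \<oplus>\<^bsub>quot_alg ?F ?T\<^esub> ?q' (CG_in m n (corr m n k i))"
        by (rule alg_hom_add[OF q(2) F.minus_closed[OF z[OF i] d[OF i]] d[OF i]])
      finally show ?thesis by (simp only: hV[OF i] hA[OF corr_closed[OF m i]])
    qed
    moreover have "\<forall>(l, r) \<in> ?T. ?q' l = ?q' r" using quot_proj_rel[OF F T] by blast
    ultimately have "\<forall>(l, r) \<in> ?R. h l = h r"
      by (subst DO_iff_tilde[OF m Q(2) h q(2)]) (simp_all only: hA)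
    with lr show "h l = h r" by blast
  qed
  have zt: "?q (Z_in m n i \<oplus>\<^bsub>?F\<^esub> CG_in m n (corr m n k i)) \<in> carrier (H_DO m n k)" if "i \<in> {1..n}" for i
    unfolding H_DO_def by (intro alg_hom_closed[OF q(1)] F.a_closed z d that)
  show ?thesis
  proof (intro exI conjI ballI)
    show "presented_by (H_DO m n k) (CG m n) (H_DO_base m n k) {1..n}
        (\<lambda>i. ?q (Z_in m n i \<oplus>\<^bsub>?F\<^esub> CG_in m n (corr m n k i))) ?T"
      using pres unfolding H_DO_def H_DO_base_def[abs_def] .
  qed (fact zt corr_commutator_closed[OF m])+
qed

end
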